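(* Let $A\,|\,B\,|\,C$ be a tower of rings such that the right $B$-module $A_B$ is finitely generated projective. Then the tower $A\,|\,B\,|\,C$ is left depth three if and only if for some positive integer $N$, $\operatorname{End} A_B$ is isomorphic, as a natural $A$-$C$-bimodule, to a direct summand of $A^N$.
   Context: Rings have identity; a tower of rings $A\,|\,B\,|\,C$ is a pair of unital ring homomorphisms $C\to B\to A$, inducing natural bimodule structures. The tower is left depth three if for some positive integer $N$, $A\otimes_B A$ is isomorphic, as a $C$-$A$-bimodule, to a direct summand of $A^N$. $\operatorname{End} A_B$ is the ring of right $B$-module endomorphisms of $A$, with natural $A$-$C$-bimodule structure via left multiplications: $(a\cdot f\cdot c)(x)=a f(cx)$ for $a,x\in A$, $c\in C$. *)

theory Defs
  imports "HOL-Algebra.Module" "HOL-Algebra.AbelCoset" "HOL-Algebra.Free_Abelian_Groups"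
begin

text \<open>
  The library's \<^typ>\<open>('a, 'b) module\<close> has commutative scalars, so one-sided modules and bimodules
  over arbitrary unital rings are introduced here.  As there, the ring record is extended only for
  its additive part: the fields \<^const>\<open>monoid.mult\<close> and \<^const>\<open>one\<close> play no role in the module
  structure.
\<close>

record ('m, 's) rmod = "'m ring" +
  rsm :: "'m \<Rightarrow> 's \<Rightarrow> 'm" (infixl \<open>\<triangleleft>\<index>\<close> 70)

record ('r, 'm, 's) bimod = "('m, 's) rmod" +
  lsm :: "'r \<Rightarrow> 'm \<Rightarrow> 'm" (infixr \<open>\<triangleright>\<index>\<close> 70)

locale right_module = S?: ring S + M?: abelian_group M
  for S :: "('s, 'x) ring_scheme" and M :: "('m, 's, 'y) rmod_scheme" (structure) +
  assumes rsm_closed: "\<lbrakk>m \<in> carrier M; s \<in> carrier S\<rbrakk> \<Longrightarrow> m \<triangleleft>\<^bsub>M\<^esub> s \<in> carrier M"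
    and rsm_add: "\<lbrakk>m \<in> carrier M; m' \<in> carrier M; s \<in> carrier S\<rbrakk> \<Longrightarrow>
          (m \<oplus>\<^bsub>M\<^esub> m') \<triangleleft>\<^bsub>M\<^esub> s = m \<triangleleft>\<^bsub>M\<^esub> s \<oplus>\<^bsub>M\<^esub> m' \<triangleleft>\<^bsub>M\<^esub> s"
    and rsm_add_scalar: "\<lbrakk>m \<in> carrier M; s \<in> carrier S; t \<in> carrier S\<rbrakk> \<Longrightarrow>
          m \<triangleleft>\<^bsub>M\<^esub> (s \<oplus>\<^bsub>S\<^esub> t) = m \<triangleleft>\<^bsub>M\<^esub> s \<oplus>\<^bsub>M\<^esub> m \<triangleleft>\<^bsub>M\<^esub> t"
    and rsm_mult: "\<lbrakk>m \<in> carrier M; s \<in> carrier S; t \<in> carrier S\<rbrakk> \<Longrightarrow>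
          m \<triangleleft>\<^bsub>M\<^esub> (s \<otimes>\<^bsub>S\<^esub> t) = (m \<triangleleft>\<^bsub>M\<^esub> s) \<triangleleft>\<^bsub>M\<^esub> t"
    and rsm_one: "m \<in> carrier M \<Longrightarrow> m \<triangleleft>\<^bsub>M\<^esub> \<one>\<^bsub>S\<^esub> = m"

locale bimodule = R?: ring R + right_module S M
  for R :: "('r, 'w) ring_scheme" and M :: "('r, 'm, 's, 'y) bimod_scheme" (structure)
    and S :: "('s, 'x) ring_scheme" +
  assumes lsm_closed: "\<lbrakk>r \<in> carrier R; m \<in> carrier M\<rbrakk> \<Longrightarrow> r \<triangleright>\<^bsub>M\<^esub> m \<in> carrier M"
    and lsm_add: "\<lbrakk>r \<in> carrier R; m \<in> carrier M; m' \<in> carrier M\<rbrakk> \<Longrightarrow>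
          r \<triangleright>\<^bsub>M\<^esub> (m \<oplus>\<^bsub>M\<^esub> m') = (r \<triangleright>\<^bsub>M\<^esub> m) \<oplus>\<^bsub>M\<^esub> (r \<triangleright>\<^bsub>M\<^esub> m')"
    and lsm_add_scalar: "\<lbrakk>r \<in> carrier R; q \<in> carrier R; m \<in> carrier M\<rbrakk> \<Longrightarrow>
          (r \<oplus>\<^bsub>R\<^esub> q) \<triangleright>\<^bsub>M\<^esub> m = (r \<triangleright>\<^bsub>M\<^esub> m) \<oplus>\<^bsub>M\<^esub> (q \<triangleright>\<^bsub>M\<^esub> m)"
    and lsm_mult: "\<lbrakk>r \<in> carrier R; q \<in> carrier R; m \<in> carrier M\<rbrakk> \<Longrightarrow>
          (r \<otimes>\<^bsub>R\<^esub> q) \<triangleright>\<^bsub>M\<^esub> m = r \<triangleright>\<^bsub>M\<^esub> (q \<triangleright>\<^bsub>M\<^esub> m)"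
    and lsm_one: "m \<in> carrier M \<Longrightarrow> \<one>\<^bsub>R\<^esub> \<triangleright>\<^bsub>M\<^esub> m = m"
    and lsm_rsm: "\<lbrakk>r \<in> carrier R; m \<in> carrier M; s \<in> carrier S\<rbrakk> \<Longrightarrow>
          (r \<triangleright>\<^bsub>M\<^esub> m) \<triangleleft>\<^bsub>M\<^esub> s = r \<triangleright>\<^bsub>M\<^esub> (m \<triangleleft>\<^bsub>M\<^esub> s)"

definition rmod_hom ::
  "('s, 'x) ring_scheme \<Rightarrow> ('m, 's, 'y) rmod_scheme \<Rightarrow> ('n, 's, 'z) rmod_scheme \<Rightarrow> ('m \<Rightarrow> 'n) set"
  where "rmod_hom S M N =
    {f \<in> carrier M \<rightarrow> carrier N.
      (\<forall>x\<in>carrier M. \<forall>y\<in>carrier M. f (x \<oplus>\<^bsub>M\<^esub> y) = f x \<oplus>\<^bsub>N\<^esub> f y) \<and>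
      (\<forall>x\<in>carrier M. \<forall>s\<in>carrier S. f (x \<triangleleft>\<^bsub>M\<^esub> s) = f x \<triangleleft>\<^bsub>N\<^esub> s)}"

definition bimod_iso ::
  "('r, 'w) ring_scheme \<Rightarrow> ('s, 'x) ring_scheme \<Rightarrow>
    ('r, 'm, 's, 'y) bimod_scheme \<Rightarrow> ('r, 'n, 's, 'z) bimod_scheme \<Rightarrow> ('m \<Rightarrow> 'n) set"
  where "bimod_iso R S M N =
    {f \<in> rmod_hom S M N. bij_betw f (carrier M) (carrier N) \<and>
      (\<forall>r\<in>carrier R. \<forall>x\<in>carrier M. f (r \<triangleright>\<^bsub>M\<^esub> x) = r \<triangleright>\<^bsub>N\<^esub> f x)}"


subsection \<open>Finitely generated projective right modules\<close>

definition finitely_generated :: "('s, 'x) ring_scheme \<Rightarrow> ('m, 's, 'y) rmod_scheme \<Rightarrow> bool"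
  where "finitely_generated S M \<longleftrightarrow>
    (\<exists>G. finite G \<and> G \<subseteq> carrier M \<and>
      (\<forall>m\<in>carrier M. \<exists>c \<in> G \<rightarrow> carrier S. m = (\<Oplus>\<^bsub>M\<^esub>g\<in>G. g \<triangleleft>\<^bsub>M\<^esub> c g)))"

text \<open>
  The lifting property.  A HOL formula cannot quantify over types, so the test modules have to
  live on fixed types.  Those chosen accommodate \<^term>\<open>M\<close> itself (as \<open>Y\<close>) and the free module of
  finitely supported functions from the carrier of \<^term>\<open>M\<close> to that of \<^term>\<open>S\<close> (as \<open>X\<close>).  Hence
  the condition forces the canonical surjection of this free module onto \<^term>\<open>M\<close> to split, and
  is the unrestricted lifting property.
\<close>

definition projective :: "('s, 'x) ring_scheme \<Rightarrow> ('m, 's, 'y) rmod_scheme \<Rightarrow> bool"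
  where "projective S M \<longleftrightarrow>
    (\<forall>(X :: ('m \<Rightarrow> 's, 's) rmod) (Y :: ('m, 's) rmod) p f.
      right_module S X \<and> right_module S Y \<and>
      p \<in> rmod_hom S X Y \<and> p ` carrier X = carrier Y \<and> f \<in> rmod_hom S M Y \<longrightarrow>
      (\<exists>h \<in> rmod_hom S M X. \<forall>m\<in>carrier M. p (h m) = f m))"


subsection \<open>Direct summands of powers\<close>

definition sub_bimodule ::
  "('r, 'w) ring_scheme \<Rightarrow> ('s, 'x) ring_scheme \<Rightarrow> 'm set \<Rightarrow> ('r, 'm, 's, 'y) bimod_scheme \<Rightarrow> bool"
  where "sub_bimodule R S K M \<longleftrightarrow>
    additive_subgroup K M \<and>
    (\<forall>r\<in>carrier R. \<forall>x\<in>K. r \<triangleright>\<^bsub>M\<^esub> x \<in> K) \<and> (\<forall>x\<in>K. \<forall>s\<in>carrier S. x \<triangleleft>\<^bsub>M\<^esub> s \<in> K)"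

definition direct_summand ::
  "('r, 'w) ring_scheme \<Rightarrow> ('s, 'x) ring_scheme \<Rightarrow> 'm set \<Rightarrow> ('r, 'm, 's, 'y) bimod_scheme \<Rightarrow> bool"
  where "direct_summand R S K M \<longleftrightarrow>
    sub_bimodule R S K M \<and>
    (\<exists>L. sub_bimodule R S L M \<and> K \<inter> L = {\<zero>\<^bsub>M\<^esub>} \<and> K <+>\<^bsub>M\<^esub> L = carrier M)"

definition iso_direct_summand ::
  "('r, 'w) ring_scheme \<Rightarrow> ('s, 'x) ring_scheme \<Rightarrow>
    ('r, 'm, 's, 'y) bimod_scheme \<Rightarrow> ('r, 'n, 's, 'z) bimod_scheme \<Rightarrow> bool"
  where "iso_direct_summand R S M N \<longleftrightarrow>
    (\<exists>K. direct_summand R S K N \<and> bimod_iso R S M (N\<lparr>carrier := K\<rparr>) \<noteq> {})"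

definition bimod_power :: "('r, 'm, 's, 'y) bimod_scheme \<Rightarrow> nat \<Rightarrow> ('r, nat \<Rightarrow> 'm, 's) bimod"
  where "bimod_power M n =
    \<lparr>carrier = {..<n} \<rightarrow>\<^sub>E carrier M,
     mult = undefined, one = undefined,
     ring.zero = (\<lambda>i\<in>{..<n}. \<zero>\<^bsub>M\<^esub>),
     add = (\<lambda>u v. \<lambda>i\<in>{..<n}. u i \<oplus>\<^bsub>M\<^esub> v i),
     rsm = (\<lambda>u s. \<lambda>i\<in>{..<n}. u i \<triangleleft>\<^bsub>M\<^esub> s),
     lsm = (\<lambda>r u. \<lambda>i\<in>{..<n}. r \<triangleright>\<^bsub>M\<^esub> u i)\<rparr>"


subsection \<open>Tensor products\<close>

definition tensor_relators ::
  "('s, 'x) ring_scheme \<Rightarrow> ('m, 's, 'y) rmod_scheme \<Rightarrow> ('s, 'n, 't, 'z) bimod_scheme \<Rightarrow>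
    ('m \<times> 'n \<Rightarrow>\<^sub>0 int) set"
  where "tensor_relators S M N =
    {frag_of (x \<oplus>\<^bsub>M\<^esub> x', y) - (frag_of (x, y) + frag_of (x', y)) | x x' y.
       x \<in> carrier M \<and> x' \<in> carrier M \<and> y \<in> carrier N} \<union>
    {frag_of (x, y \<oplus>\<^bsub>N\<^esub> y') - (frag_of (x, y) + frag_of (x, y')) | x y y'.
       x \<in> carrier M \<and> y \<in> carrier N \<and> y' \<in> carrier N} \<union>
    {frag_of (x \<triangleleft>\<^bsub>M\<^esub> s, y) - frag_of (x, s \<triangleright>\<^bsub>N\<^esub> y) | x s y.
       x \<in> carrier M \<and> s \<in> carrier S \<and> y \<in> carrier N}"

abbreviation tensor_gens ::
  "('m, 's, 'y) rmod_scheme \<Rightarrow> ('s, 'n, 't, 'z) bimod_scheme \<Rightarrow> ('m \<times> 'n \<Rightarrow>\<^sub>0 int) monoid"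
  where "tensor_gens M N \<equiv> free_Abelian_group (carrier M \<times> carrier N)"

definition tensor_kernel ::
  "('s, 'x) ring_scheme \<Rightarrow> ('m, 's, 'y) rmod_scheme \<Rightarrow> ('s, 'n, 't, 'z) bimod_scheme \<Rightarrow>
    ('m \<times> 'n \<Rightarrow>\<^sub>0 int) set"
  where "tensor_kernel S M N = generate (tensor_gens M N) (tensor_relators S M N)"

text \<open>
  Elements of the tensor product over \<^term>\<open>S\<close> of an \<open>R\<close>-\<open>S\<close>-bimodule and an \<open>S\<close>-\<open>T\<close>-bimodule are
  cosets of \<^const>\<open>tensor_kernel\<close>.  A scalar acts on a coset \<open>X\<close> through the additive extension of
  its action on generators.  This extension maps the kernel into itself, so the image of \<open>X\<close> lies
  in a single coset, which is recovered by adding the kernel.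
\<close>

definition bimod_tensor ::
  "('s, 'x) ring_scheme \<Rightarrow> ('r, 'm, 's, 'y) bimod_scheme \<Rightarrow> ('s, 'n, 't, 'z) bimod_scheme \<Rightarrow>
    ('r, ('m \<times> 'n \<Rightarrow>\<^sub>0 int) set, 't) bimod"
  where "bimod_tensor S M N =
    (let F = tensor_gens M N; K = tensor_kernel S M N in
     \<lparr>carrier = carrier (F Mod K),
      mult = undefined, one = undefined,
      ring.zero = \<one>\<^bsub>F Mod K\<^esub>,
      add = monoid.mult (F Mod K),
      rsm = (\<lambda>X t. K <#>\<^bsub>F\<^esub> frag_extend (\<lambda>(x, y). frag_of (x, y \<triangleleft>\<^bsub>N\<^esub> t)) ` X),
      lsm = (\<lambda>r X. K <#>\<^bsub>F\<^esub> frag_extend (\<lambda>(x, y). frag_of (r \<triangleright>\<^bsub>M\<^esub> x, y)) ` X)\<rparr>)"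


subsection \<open>Towers of rings\<close>

locale ring_tower = A?: ring A + B?: ring B + C?: ring C
  for A :: "('a, 'x) ring_scheme" (structure)
    and B :: "('b, 'y) ring_scheme" and C :: "('c, 'z) ring_scheme" +
  fixes \<beta> :: "'b \<Rightarrow> 'a" and \<gamma> :: "'c \<Rightarrow> 'b"
  assumes beta_hom: "\<beta> \<in> ring_hom B A"
    and gamma_hom: "\<gamma> \<in> ring_hom C B"

text \<open>The ring \<^term>\<open>A\<close> with scalars acting on the left through \<open>f\<close> and on the right through \<open>g\<close>.\<close>

definition ring_bimod ::
  "('a, 'x) ring_scheme \<Rightarrow> ('r \<Rightarrow> 'a) \<Rightarrow> ('s \<Rightarrow> 'a) \<Rightarrow> ('r, 'a, 's) bimod"
  where "ring_bimod A f g =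
    \<lparr>carrier = carrier A, mult = monoid.mult A, one = one A, ring.zero = ring.zero A, add = add A,
     rsm = (\<lambda>x s. x \<otimes>\<^bsub>A\<^esub> g s),
     lsm = (\<lambda>r x. f r \<otimes>\<^bsub>A\<^esub> x)\<rparr>"

definition left_depth_three ::
  "('a, 'x) ring_scheme \<Rightarrow> ('b, 'y) ring_scheme \<Rightarrow> ('c, 'z) ring_scheme \<Rightarrow>
    ('b \<Rightarrow> 'a) \<Rightarrow> ('c \<Rightarrow> 'b) \<Rightarrow> bool"
  where "left_depth_three A B C \<beta> \<gamma> \<longleftrightarrow>
    (\<exists>N::nat. 0 < N \<and>
      iso_direct_summand C A
        (bimod_tensor B (ring_bimod A (\<beta> \<circ> \<gamma>) \<beta>) (ring_bimod A \<beta> id))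
        (bimod_power (ring_bimod A (\<beta> \<circ> \<gamma>) id) N))"

text \<open>
  Right \<^term>\<open>B\<close>-linear endomorphisms are taken to be extensional on the carrier of \<^term>\<open>A\<close>, so that
  equality of endomorphisms is equality in HOL.
\<close>

definition End_bimod ::
  "('a, 'x) ring_scheme \<Rightarrow> ('b, 'y) ring_scheme \<Rightarrow> ('b \<Rightarrow> 'a) \<Rightarrow> ('c \<Rightarrow> 'b) \<Rightarrow>
    ('a, 'a \<Rightarrow> 'a, 'c) bimod"
  where "End_bimod A B \<beta> \<gamma> =
    \<lparr>carrier = rmod_hom B (ring_bimod A id \<beta>) (ring_bimod A id \<beta>) \<inter> extensional (carrier A),
     mult = compose (carrier A),
     one = (\<lambda>x\<in>carrier A. x),
     ring.zero = (\<lambda>x\<in>carrier A. \<zero>\<^bsub>A\<^esub>),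
     add = (\<lambda>f g. \<lambda>x\<in>carrier A. f x \<oplus>\<^bsub>A\<^esub> g x),
     rsm = (\<lambda>f c. \<lambda>x\<in>carrier A. f (\<beta> (\<gamma> c) \<otimes>\<^bsub>A\<^esub> x)),
     lsm = (\<lambda>a f. \<lambda>x\<in>carrier A. a \<otimes>\<^bsub>A\<^esub> f x)\<rparr>"

end

theory Submission
  imports Defs
begin

text \<open>
  Being a direct summand of \<open>A\<^sup>n\<close> means that the identity of the module is a sum of \<open>n\<close>
  composites through \<open>A\<close>.  For the tensor square and for \<open>End A\<^sub>B\<close> this data has the same shape,
  namely that of a quasibase: endomorphisms \<open>U\<^sub>k\<close> commuting with left multiplication by \<open>C\<close> and
  \<open>C\<close>-central tensors \<open>t\<^sub>k\<close> with \<open>x \<otimes> 1 = \<Sum> t\<^sub>k U\<^sub>k(x)\<close> for all \<open>x\<close>.  Given a quasibase, applying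
  \<open>y \<otimes> z \<mapsto> f(y) z\<close> yields \<open>f = \<Sum> f(t\<^sub>k\<^sup>1) t\<^sub>k\<^sup>2 U\<^sub>k\<close>, which splits \<open>End A\<^sub>B\<close> off \<open>A\<^sup>n\<close>.  Conversely, if
  \<open>f = \<Sum> p\<^sub>k(f) U\<^sub>k\<close> for all \<open>f\<close>, then a dual basis \<open>(g, \<phi>\<^sub>g)\<close> of \<open>A\<^sub>B\<close> gives the central tensors
  \<open>t\<^sub>k = \<Sum> g \<otimes> p\<^sub>k(\<phi>\<^sub>g)\<close>.
\<close>

subsection \<open>Bimodule homomorphisms and direct summands of powers\<close>

lemma (in abelian_group_hom) hom_finsum:
  assumes "g \<in> I \<rightarrow> carrier G"
  shows "h (\<Oplus>\<^bsub>G\<^esub>i\<in>I. g i) = (\<Oplus>\<^bsub>H\<^esub>i\<in>I. h (g i))"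
  using assms
\<comment> \<open>Infinite index sets are included: both sums then take the default value zero,
  which \<open>h\<close> preserves.\<close>
proof (induction I rule: infinite_finite_induct)
  case (insert i I)
  then have "(\<lambda>i. h (g i)) \<in> I \<rightarrow> carrier H" "h (g i) \<in> carrier H" by (auto simp: Pi_iff)
  with insert show ?case by (simp add: G.finsum_insert H.finsum_insert Pi_iff)
qed (simp_all add: G.add.finprod_infinite finsum_def finprod_def)

lemma abelian_group_homI':
  assumes "abelian_group G" "abelian_group H" "h \<in> carrier G \<rightarrow> carrier H"
    and "\<And>x y. x \<in> carrier G \<Longrightarrow> y \<in> carrier G \<Longrightarrow> h (x \<oplus>\<^bsub>G\<^esub> y) = h x \<oplus>\<^bsub>H\<^esub> h y"
  shows "abelian_group_hom G H h"
  using assms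
  by (auto intro!: abelian_group_homI group_hom.intro group_hom_axioms.intro abelian_group.a_group simp: hom_def)

lemma (in abelian_group) finsum_swap:
  assumes "finite I" "finite J" "\<And>i j. i \<in> I \<Longrightarrow> j \<in> J \<Longrightarrow> f i j \<in> carrier G"
  shows "(\<Oplus>i\<in>I. \<Oplus>j\<in>J. f i j) = (\<Oplus>j\<in>J. \<Oplus>i\<in>I. f i j)"
  using assms(1,3)
proof (induction I)
  case (insert i I)
  have "(\<Oplus>i\<in>insert i I. \<Oplus>j\<in>J. f i j) = (\<Oplus>j\<in>J. f i j) \<oplus> (\<Oplus>j\<in>J. \<Oplus>i\<in>I. f i j)"
    using insert by (subst finsum_insert) (auto intro!: finsum_closed)
  also have "\<dots> = (\<Oplus>j\<in>J. f i j \<oplus> (\<Oplus>i\<in>I. f i j))"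
    using insert by (subst finsum_addf) (auto intro!: finsum_closed)
  also have "\<dots> = (\<Oplus>j\<in>J. \<Oplus>i\<in>insert i I. f i j)"
    using insert by (intro finsum_cong') (auto intro!: finsum_closed simp: finsum_insert)
  finally show ?case .
qed simp

text \<open>The inclusions and projections that split off a summand are not bijective, so they need
  a notion weaker than \<open>bimod_iso\<close>.\<close>

definition bimod_hom ::
  "('r, 'w) ring_scheme \<Rightarrow> ('s, 'x) ring_scheme \<Rightarrow>
    ('r, 'm, 's, 'y) bimod_scheme \<Rightarrow> ('r, 'n, 's, 'z) bimod_scheme \<Rightarrow> ('m \<Rightarrow> 'n) set"
  where "bimod_hom R S M N =
    {f \<in> rmod_hom S M N. \<forall>r\<in>carrier R. \<forall>x\<in>carrier M. f (r \<triangleright>\<^bsub>M\<^esub> x) = r \<triangleright>\<^bsub>N\<^esub> f x}"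

lemma bimod_homI:
  assumes "\<And>x. x \<in> carrier M \<Longrightarrow> f x \<in> carrier N"
    and "\<And>x y. x \<in> carrier M \<Longrightarrow> y \<in> carrier M \<Longrightarrow> f (x \<oplus>\<^bsub>M\<^esub> y) = f x \<oplus>\<^bsub>N\<^esub> f y"
    and "\<And>x s. x \<in> carrier M \<Longrightarrow> s \<in> carrier S \<Longrightarrow> f (x \<triangleleft>\<^bsub>M\<^esub> s) = f x \<triangleleft>\<^bsub>N\<^esub> s"
    and "\<And>r x. r \<in> carrier R \<Longrightarrow> x \<in> carrier M \<Longrightarrow> f (r \<triangleright>\<^bsub>M\<^esub> x) = r \<triangleright>\<^bsub>N\<^esub> f x"
  shows "f \<in> bimod_hom R S M N"
  using assms by (simp add: bimod_hom_def rmod_hom_def)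

lemma bimod_homD:
  assumes "f \<in> bimod_hom R S M N"
  shows "x \<in> carrier M \<Longrightarrow> f x \<in> carrier N"
    and "x \<in> carrier M \<Longrightarrow> y \<in> carrier M \<Longrightarrow> f (x \<oplus>\<^bsub>M\<^esub> y) = f x \<oplus>\<^bsub>N\<^esub> f y"
    and "x \<in> carrier M \<Longrightarrow> s \<in> carrier S \<Longrightarrow> f (x \<triangleleft>\<^bsub>M\<^esub> s) = f x \<triangleleft>\<^bsub>N\<^esub> s"
    and "r \<in> carrier R \<Longrightarrow> x \<in> carrier M \<Longrightarrow> f (r \<triangleright>\<^bsub>M\<^esub> x) = r \<triangleright>\<^bsub>N\<^esub> f x"
  using assms by (auto simp add: bimod_hom_def rmod_hom_def)

lemma bimodule_abelian_group: "bimodule R M S \<Longrightarrow> abelian_group M"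
  by (simp add: bimodule_def right_module_def)

lemma bimod_hom_abelian_group_hom:
  "\<lbrakk>f \<in> bimod_hom R S M N; bimodule R M S; bimodule R N S\<rbrakk> \<Longrightarrow> abelian_group_hom M N f"
  by (rule abelian_group_homI') (auto simp: bimodule_abelian_group bimod_homD)

lemma (in bimodule) rsm_hom: "s \<in> carrier S \<Longrightarrow> abelian_group_hom M M (\<lambda>m. m \<triangleleft> s)"
  by (rule abelian_group_homI') (auto simp: rsm_closed rsm_add M.abelian_group_axioms)

lemma (in bimodule) lsm_hom: "r \<in> carrier R \<Longrightarrow> abelian_group_hom M M (\<lambda>m. r \<triangleright> m)"
  by (rule abelian_group_homI') (auto simp: lsm_closed lsm_add M.abelian_group_axioms)

section \<open>Direct summands as split inclusions\<close>

lemma (in abelian_group) additive_subgroupI':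
  assumes "K \<subseteq> carrier G" "\<zero> \<in> K" "\<And>x y. x \<in> K \<Longrightarrow> y \<in> K \<Longrightarrow> x \<oplus> y \<in> K"
    "\<And>x. x \<in> K \<Longrightarrow> \<ominus> x \<in> K"
  shows "additive_subgroup K G"
  using assms by (auto intro!: additive_subgroupI add.subgroupI simp: a_inv_def)

lemma (in abelian_group) minus_eq_zero_imp_eq:
  "\<lbrakk>a \<in> carrier G; b \<in> carrier G; a \<ominus> b = \<zero>\<rbrakk> \<Longrightarrow> a = b"
  by (metis a_inv_closed a_minus_def minus_equality minus_minus)

text \<open>Since \<open>r\<close> is a left inverse of \<open>i\<close>, the composite of
  \<open>r\<close> followed by \<open>i\<close> is an idempotent endomorphism of \<open>Q\<close>.
  Hence \<open>Q\<close> is the direct sum of the image \<open>K\<close> of \<open>i\<close> and the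
  kernel \<open>L\<close> of \<open>r\<close>.\<close>

lemma split_imp_iso_direct_summand:
  assumes M: "bimodule R M S" and Q: "bimodule R Q S"
    and i: "i \<in> bimod_hom R S M Q" and r: "r \<in> bimod_hom R S Q M"
    and ri: "\<And>m. m \<in> carrier M \<Longrightarrow> r (i m) = m"
  shows "iso_direct_summand R S M Q"
proof -
  interpret M: bimodule R M S by fact
  interpret Q: bimodule R Q S by fact
  interpret i: abelian_group_hom M Q i by (rule bimod_hom_abelian_group_hom) fact+
  interpret r: abelian_group_hom Q M r by (rule bimod_hom_abelian_group_hom) fact+
  note i' = bimod_homD[OF i] and r' = bimod_homD[OF r]
  define K where "K = i ` carrier M"
  define L where "L = {q \<in> carrier Q. r q = \<zero>\<^bsub>M\<^esub>}"
  have "additive_subgroup K Q"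
    unfolding K_def
    apply (rule Q.additive_subgroupI')
    subgoal by auto
    subgoal by (metis M.M.zero_closed i.hom_zero image_eqI)
    subgoal by (auto simp: simp flip: i.hom_add)
    subgoal by (auto simp: simp flip: i.hom_a_inv)
    done
  then have K: "sub_bimodule R S K Q"
    by (auto simp: sub_bimodule_def K_def M.rsm_closed M.lsm_closed simp flip: i'(3,4))
  have "additive_subgroup L Q"
    unfolding L_def by (rule Q.additive_subgroupI') auto
  moreover have "s \<in> carrier S \<Longrightarrow> \<zero>\<^bsub>M\<^esub> \<triangleleft>\<^bsub>M\<^esub> s = \<zero>\<^bsub>M\<^esub>" for s
    using abelian_group_hom.hom_zero[OF M.rsm_hom] .
  moreover have "s \<in> carrier R \<Longrightarrow> s \<triangleright>\<^bsub>M\<^esub> \<zero>\<^bsub>M\<^esub> = \<zero>\<^bsub>M\<^esub>" for s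
    using abelian_group_hom.hom_zero[OF M.lsm_hom] .
  ultimately have L: "sub_bimodule R S L Q"
    by (auto simp: sub_bimodule_def L_def Q.rsm_closed Q.lsm_closed r')
  have KL: "K \<inter> L = {\<zero>\<^bsub>Q\<^esub>}"
    using additive_subgroup.zero_closed[of K Q] additive_subgroup.zero_closed[of L Q] K L
    by (auto simp: sub_bimodule_def) (auto simp: K_def L_def ri)
  have "q \<in> K <+>\<^bsub>Q\<^esub> L" if q: "q \<in> carrier Q" for q
  proof -
    have "i (r q) \<in> K" "q \<ominus>\<^bsub>Q\<^esub> i (r q) \<in> L"
      using q by (auto simp: K_def L_def a_minus_def ri M.M.r_neg)
    moreover have "q = i (r q) \<oplus>\<^bsub>Q\<^esub> (q \<ominus>\<^bsub>Q\<^esub> i (r q))"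
      using q by (simp add: a_minus_def Q.M.add.m_lcomm Q.M.r_neg)
    ultimately show ?thesis by (auto simp: set_add_def set_mult_def)
  qed
  then have "K <+>\<^bsub>Q\<^esub> L = carrier Q"
    by (auto simp: set_add_def set_mult_def K_def L_def)
  then have "direct_summand R S K Q" using K L KL by (auto simp: direct_summand_def)
  moreover have "i \<in> bimod_iso R S M (Q\<lparr>carrier := K\<rparr>)"
    using i' by (auto simp: bimod_iso_def rmod_hom_def K_def bij_betw_def intro: inj_on_inverseI ri)
  ultimately show ?thesis unfolding iso_direct_summand_def by blast
qed

text \<open>The retraction is the projection onto the summand along its complement, followed by the
  inverse of the isomorphism.\<close>

lemma iso_direct_summand_imp_split:
  assumes M: "bimodule R M S" and Q: "bimodule R Q S" and "iso_direct_summand R S M Q"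
  obtains i r where "i \<in> bimod_hom R S M Q" "r \<in> bimod_hom R S Q M"
    "\<And>m. m \<in> carrier M \<Longrightarrow> r (i m) = m"
proof -
  interpret M: bimodule R M S by fact
  interpret Q: bimodule R Q S by fact
  obtain K L i where K: "sub_bimodule R S K Q" and L: "sub_bimodule R S L Q"
    and KL: "K \<inter> L = {\<zero>\<^bsub>Q\<^esub>}" "K <+>\<^bsub>Q\<^esub> L = carrier Q"
    and i: "i \<in> bimod_iso R S M (Q\<lparr>carrier := K\<rparr>)"
    using assms(3) unfolding iso_direct_summand_def direct_summand_def by blast
  interpret K: additive_subgroup K Q using K by (simp add: sub_bimodule_def)
  interpret L: additive_subgroup L Q using L by (simp add: sub_bimodule_def)
  have bij: "bij_betw i (carrier M) K" using i by (auto simp: bimod_iso_def)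
  then have iK: "i m \<in> K" if "m \<in> carrier M" for m using that by (auto simp: bij_betw_def)
  have ih: "i \<in> bimod_hom R S M Q"
    using i iK K.a_Hcarr by (auto simp: bimod_iso_def bimod_hom_def rmod_hom_def)
  note i' = bimod_homD[OF ih]
  \<comment> \<open>Two decompositions of one element differ by
    \<open>i m \<ominus> i m' = l' \<ominus> l\<close>, which lies in both \<open>K\<close> and
    \<open>L\<close> and is therefore zero.\<close>
  have uniq: "m = m'" "l = l'"
    if "m \<in> carrier M" "m' \<in> carrier M" "l \<in> L" "l' \<in> L"
      "i m \<oplus>\<^bsub>Q\<^esub> l = i m' \<oplus>\<^bsub>Q\<^esub> l'" for m m' l l'
  proof -
    have c: "i m \<in> carrier Q" "i m' \<in> carrier Q" "l \<in> carrier Q" "l' \<in> carrier Q"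
      using that by (auto simp: i' L.a_Hcarr)
    have "i m \<ominus>\<^bsub>Q\<^esub> i m' = l' \<ominus>\<^bsub>Q\<^esub> l"
    proof -
      have "i m = (i m' \<oplus>\<^bsub>Q\<^esub> l') \<ominus>\<^bsub>Q\<^esub> l"
        using c by (simp flip: that(5) add: a_minus_def Q.M.a_assoc Q.M.r_neg)
      then show ?thesis
        using c by (simp add: a_minus_def Q.M.a_ac) (metis Q.M.add.inv_closed Q.M.add.m_lcomm Q.M.l_neg Q.M.r_zero Q.M.a_comm)
    qed
    moreover have "i m \<ominus>\<^bsub>Q\<^esub> i m' \<in> K" "l' \<ominus>\<^bsub>Q\<^esub> l \<in> L"
      using that iK by (auto simp: a_minus_def)
    ultimately have "i m \<ominus>\<^bsub>Q\<^esub> i m' = \<zero>\<^bsub>Q\<^esub>" "l' \<ominus>\<^bsub>Q\<^esub> l = \<zero>\<^bsub>Q\<^esub>" using KL(1) by auto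
    then have "i m = i m'" "l = l'" using c by (auto dest: Q.M.minus_eq_zero_imp_eq)
    then show "m = m'" "l = l'" using bij that by (auto simp: bij_betw_def inj_on_def)
  qed
  \<comment> \<open>On the carrier of \<open>Q\<close> the description is met by exactly one
    \<open>m\<close>: existence is \<open>ex\<close> below, and uniqueness is
    \<open>uniq\<close>.\<close>
  define r where "r q = (THE m. m \<in> carrier M \<and> (\<exists>l\<in>L. q = i m \<oplus>\<^bsub>Q\<^esub> l))" for q
  have r_eq: "r (i m \<oplus>\<^bsub>Q\<^esub> l) = m" if "m \<in> carrier M" "l \<in> L" for m l
    unfolding r_def using that by (intro the_equality) (auto dest: uniq)
  have ex: "\<exists>m\<in>carrier M. \<exists>l\<in>L. q = i m \<oplus>\<^bsub>Q\<^esub> l" if "q \<in> carrier Q" for q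
    using that bij unfolding KL(2)[symmetric] by (force simp: set_add_def set_mult_def bij_betw_def)
  have "r \<in> bimod_hom R S Q M"
  proof (rule bimod_homI)
    fix q assume "q \<in> carrier Q"
    then obtain m l where q: "m \<in> carrier M" "l \<in> L" "q = i m \<oplus>\<^bsub>Q\<^esub> l" using ex by blast
    then show "r q \<in> carrier M" by (simp add: r_eq)
    have c: "i m \<in> carrier Q" "l \<in> carrier Q" using q by (auto simp: i' L.a_Hcarr)
    show "r (q \<triangleleft>\<^bsub>Q\<^esub> s) = r q \<triangleleft>\<^bsub>M\<^esub> s" if s: "s \<in> carrier S" for s
    proof -
      have "q \<triangleleft>\<^bsub>Q\<^esub> s = i (m \<triangleleft>\<^bsub>M\<^esub> s) \<oplus>\<^bsub>Q\<^esub> l \<triangleleft>\<^bsub>Q\<^esub> s" using q s c by (simp add: Q.rsm_add i')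
      moreover have "l \<triangleleft>\<^bsub>Q\<^esub> s \<in> L" using L q s by (auto simp: sub_bimodule_def)
      ultimately show ?thesis using q s by (simp add: r_eq M.rsm_closed)
    qed
    show "r (s \<triangleright>\<^bsub>Q\<^esub> q) = s \<triangleright>\<^bsub>M\<^esub> r q" if s: "s \<in> carrier R" for s
    proof -
      have "s \<triangleright>\<^bsub>Q\<^esub> q = i (s \<triangleright>\<^bsub>M\<^esub> m) \<oplus>\<^bsub>Q\<^esub> (s \<triangleright>\<^bsub>Q\<^esub> l)" using q s c by (simp add: Q.lsm_add i')
      moreover have "s \<triangleright>\<^bsub>Q\<^esub> l \<in> L" using L q s by (auto simp: sub_bimodule_def)
      ultimately show ?thesis using q s by (simp add: r_eq M.lsm_closed)
    qed
    fix q' assume "q' \<in> carrier Q"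
    then obtain m' l' where q': "m' \<in> carrier M" "l' \<in> L" "q' = i m' \<oplus>\<^bsub>Q\<^esub> l'" using ex by blast
    have c': "i m' \<in> carrier Q" "l' \<in> carrier Q" using q' by (auto simp: i' L.a_Hcarr)
    have "q \<oplus>\<^bsub>Q\<^esub> q' = i (m \<oplus>\<^bsub>M\<^esub> m') \<oplus>\<^bsub>Q\<^esub> (l \<oplus>\<^bsub>Q\<^esub> l')"
      using q q' c c' by (simp add: i' Q.M.a_ac)
    then show "r (q \<oplus>\<^bsub>Q\<^esub> q') = r q \<oplus>\<^bsub>M\<^esub> r q'" using q q' by (simp add: r_eq)
  qed
  moreover have "r (i m) = m" if "m \<in> carrier M" for m
    using r_eq[OF that L.zero_closed] that by (simp add: i')
  ultimately show thesis using that ih by blast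
qed

section \<open>Powers of a bimodule\<close>

lemma bimod_power_simps [simp]:
  "carrier (bimod_power P n) = {..<n} \<rightarrow>\<^sub>E carrier P"
  "\<zero>\<^bsub>bimod_power P n\<^esub> = (\<lambda>i\<in>{..<n}. \<zero>\<^bsub>P\<^esub>)"
  "u \<oplus>\<^bsub>bimod_power P n\<^esub> v = (\<lambda>i\<in>{..<n}. u i \<oplus>\<^bsub>P\<^esub> v i)"
  "u \<triangleleft>\<^bsub>bimod_power P n\<^esub> s = (\<lambda>i\<in>{..<n}. u i \<triangleleft>\<^bsub>P\<^esub> s)"
  "r \<triangleright>\<^bsub>bimod_power P n\<^esub> u = (\<lambda>i\<in>{..<n}. r \<triangleright>\<^bsub>P\<^esub> u i)"
  by (simp_all add: bimod_power_def)

lemma bimodule_bimod_power: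
  assumes "bimodule R P S"
  shows "bimodule R (bimod_power P n) S"
proof -
  interpret P: bimodule R P S by fact
  have "abelian_group (bimod_power P n)"
    apply (rule abelian_groupI)
    apply (auto simp: fun_eq_iff PiE_mem P.M.a_ac extensional_def PiE_iff )
    subgoal for x by (rule bexI[of _ "\<lambda>i\<in>{..<n}. \<ominus>\<^bsub>P\<^esub> x i"]) (auto simp: P.M.r_neg PiE_iff)
    done
  then show ?thesis
    apply (intro bimodule.intro right_module.intro bimodule_axioms.intro right_module_axioms.intro P.R.ring_axioms P.S.ring_axioms)
    apply (auto simp: fun_eq_iff PiE_iff extensional_def P.rsm_closed P.rsm_add
      P.rsm_add_scalar P.rsm_mult P.rsm_one P.lsm_closed P.lsm_add P.lsm_add_scalar P.lsm_mult
      P.lsm_one P.lsm_rsm)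
    done
qed

text \<open>A map into the power is a tuple of maps into \<open>P\<close>, and a map out of it is
  the sum of its restrictions to the coordinates. A retraction thus becomes a decomposition of the
  identity of \<open>M\<close>. Both sides of the theorem are rewritten with this criterion.\<close>

lemma iso_direct_summand_power_iff:
  assumes M: "bimodule R M S" and P: "bimodule R P S"
  shows "iso_direct_summand R S M (bimod_power P n) \<longleftrightarrow>
    (\<exists>u v. (\<forall>k<n. u k \<in> bimod_hom R S M P) \<and> (\<forall>k<n. v k \<in> bimod_hom R S P M) \<and>
      (\<forall>m\<in>carrier M. (\<Oplus>\<^bsub>M\<^esub>k\<in>{..<n}. v k (u k m)) = m))"
  (is "?lhs \<longleftrightarrow> ?rhs")
proof -
  interpret M: bimodule R M S by fact
  interpret P: bimodule R P S by fact
  let ?Q = "bimod_power P n"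
  have Q: "bimodule R ?Q S" by (rule bimodule_bimod_power) fact
  interpret Q: bimodule R ?Q S by fact
  show ?thesis
  proof
    assume ?lhs
    then obtain i r where ir: "i \<in> bimod_hom R S M ?Q" "r \<in> bimod_hom R S ?Q M"
      and id: "\<And>m. m \<in> carrier M \<Longrightarrow> r (i m) = m"
      using iso_direct_summand_imp_split[OF M Q] by blast
    note i = bimod_homD[OF ir(1)] and r = bimod_homD[OF ir(2)]
    interpret r: abelian_group_hom ?Q M r by (rule bimod_hom_abelian_group_hom) fact+
    \<comment> \<open>\<open>e k\<close> is the inclusion of the \<open>k\<close>-th coordinate;
      \<open>sum\<close> below recovers a tuple from its components.\<close>
    define e where "e k p = (\<lambda>j\<in>{..<n}. if j = k then p else \<zero>\<^bsub>P\<^esub>)" for k p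
    have zero: "s \<in> carrier S \<Longrightarrow> \<zero>\<^bsub>P\<^esub> \<triangleleft>\<^bsub>P\<^esub> s = \<zero>\<^bsub>P\<^esub>" "s' \<in> carrier R \<Longrightarrow> s' \<triangleright>\<^bsub>P\<^esub> \<zero>\<^bsub>P\<^esub> = \<zero>\<^bsub>P\<^esub>" for s s'
      using abelian_group_hom.hom_zero[OF P.rsm_hom] abelian_group_hom.hom_zero[OF P.lsm_hom] by auto
    have e: "e k \<in> bimod_hom R S P ?Q" for k
      by (rule bimod_homI) (auto simp: e_def zero fun_eq_iff)
    have sum: "(\<Oplus>\<^bsub>?Q\<^esub>k\<in>{..<n}. e k (q k)) = q" if q: "q \<in> carrier ?Q" for q
    proof
      fix j
      have c: "(\<lambda>k. e k (q k)) \<in> {..<n} \<rightarrow> carrier ?Q" using q bimod_homD(1)[OF e] by (auto simp: PiE_iff)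
      show "(\<Oplus>\<^bsub>?Q\<^esub>k\<in>{..<n}. e k (q k)) j = q j"
      proof (cases "j < n")
        case True
        interpret ev: abelian_group_hom ?Q P "\<lambda>q. q j"
          using True by (intro abelian_group_homI' Q.M.abelian_group_axioms P.M.abelian_group_axioms) auto
        have "(\<Oplus>\<^bsub>?Q\<^esub>k\<in>{..<n}. e k (q k)) j = (\<Oplus>\<^bsub>P\<^esub>k\<in>{..<n}. e k (q k) j)"
          using ev.hom_finsum[OF c] .
        also have "\<dots> = (\<Oplus>\<^bsub>P\<^esub>k\<in>{..<n}. if j = k then q k else \<zero>\<^bsub>P\<^esub>)"
          using q True by (intro P.M.finsum_cong') (auto simp: e_def PiE_iff)
        also have "\<dots> = q j"
          using q True by (intro P.M.finsum_singleton) (auto simp: PiE_iff)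
        finally show ?thesis .
      next
        \<comment> \<open>Both sides lie in the extensional carrier, so outside
          \<open>{..<n}\<close> they share the value \<open>undefined\<close>.\<close>
        case False
        moreover have "(\<Oplus>\<^bsub>?Q\<^esub>k\<in>{..<n}. e k (q k)) \<in> carrier ?Q" using c by (rule Q.M.finsum_closed)
        ultimately show ?thesis using q by (auto simp: PiE_iff extensional_def)
      qed
    qed
    have "(\<lambda>m. i m k) \<in> bimod_hom R S M P" if "k < n" for k
    proof (rule bimod_homI)
      show "i x k \<in> carrier P" if "x \<in> carrier M" for x using i(1)[OF that] \<open>k < n\<close> by auto
    qed (use \<open>k < n\<close> in \<open>simp_all add: i\<close>)
    moreover have "(\<lambda>p. r (e k p)) \<in> bimod_hom R S P M" for k
      by (rule bimod_homI) (simp_all only: r bimod_homD[OF e])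
    moreover have "(\<Oplus>\<^bsub>M\<^esub>k\<in>{..<n}. r (e k (i m k))) = m" if "m \<in> carrier M" for m
    proof -
      have "(\<lambda>k. e k (i m k)) \<in> {..<n} \<rightarrow> carrier ?Q"
        using i(1)[OF that] bimod_homD(1)[OF e] by (auto simp: PiE_iff)
      from r.hom_finsum[OF this] sum[OF i(1)[OF that]] id[OF that] show ?thesis by simp
    qed
    ultimately show ?rhs
      by (intro exI[of _ "\<lambda>k m. i m k"] exI[of _ "\<lambda>k p. r (e k p)"]) auto
  next
    assume ?rhs
    then obtain u v where u: "\<And>k. k < n \<Longrightarrow> u k \<in> bimod_hom R S M P"
      and v: "\<And>k. k < n \<Longrightarrow> v k \<in> bimod_hom R S P M"
      and id: "\<And>m. m \<in> carrier M \<Longrightarrow> (\<Oplus>\<^bsub>M\<^esub>k\<in>{..<n}. v k (u k m)) = m" by blast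
    note u' = bimod_homD[OF u] and v' = bimod_homD[OF v]
    \<comment> \<open>The two families assemble into one map into the power and one map out of it;
      \<open>id\<close> says that the second retracts the first.\<close>
    have "(\<lambda>m. \<lambda>k\<in>{..<n}. u k m) \<in> bimod_hom R S M ?Q"
      by (rule bimod_homI) (auto simp: u' fun_eq_iff)
    moreover have "(\<lambda>q. \<Oplus>\<^bsub>M\<^esub>k\<in>{..<n}. v k (q k)) \<in> bimod_hom R S ?Q M"
    proof (rule bimod_homI)
      fix q assume q: "q \<in> carrier ?Q"
      then have c: "(\<lambda>k. v k (q k)) \<in> {..<n} \<rightarrow> carrier M" by (auto intro!: v')
      then show "(\<Oplus>\<^bsub>M\<^esub>k\<in>{..<n}. v k (q k)) \<in> carrier M" by (rule M.M.finsum_closed)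
      show "(\<Oplus>\<^bsub>M\<^esub>k\<in>{..<n}. v k ((q \<triangleleft>\<^bsub>?Q\<^esub> s) k)) = (\<Oplus>\<^bsub>M\<^esub>k\<in>{..<n}. v k (q k)) \<triangleleft>\<^bsub>M\<^esub> s"
        if "s \<in> carrier S" for s
        using that q c unfolding abelian_group_hom.hom_finsum[OF M.rsm_hom[OF that] c]
        by (intro M.M.finsum_cong') (auto simp: v' PiE_iff M.rsm_closed)
      show "(\<Oplus>\<^bsub>M\<^esub>k\<in>{..<n}. v k ((s \<triangleright>\<^bsub>?Q\<^esub> q) k)) = s \<triangleright>\<^bsub>M\<^esub> (\<Oplus>\<^bsub>M\<^esub>k\<in>{..<n}. v k (q k))"
        if "s \<in> carrier R" for s
        using that q c unfolding abelian_group_hom.hom_finsum[OF M.lsm_hom[OF that] c]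
        by (intro M.M.finsum_cong') (auto simp: v' PiE_iff M.lsm_closed)
      fix q' assume q': "q' \<in> carrier ?Q"
      then have c': "(\<lambda>k. v k (q' k)) \<in> {..<n} \<rightarrow> carrier M" by (auto intro!: v')
      show "(\<Oplus>\<^bsub>M\<^esub>k\<in>{..<n}. v k ((q \<oplus>\<^bsub>?Q\<^esub> q') k)) =
          (\<Oplus>\<^bsub>M\<^esub>k\<in>{..<n}. v k (q k)) \<oplus>\<^bsub>M\<^esub> (\<Oplus>\<^bsub>M\<^esub>k\<in>{..<n}. v k (q' k))"
        using q q' c c' unfolding M.M.finsum_addf[OF c c', symmetric]
        by (intro M.M.finsum_cong') (auto simp: v' PiE_iff)
    qed
    moreover have "(\<Oplus>\<^bsub>M\<^esub>k\<in>{..<n}. v k ((\<lambda>k\<in>{..<n}. u k m) k)) = m" if "m \<in> carrier M" for m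
      using id[OF that] by (subst M.M.finsum_cong'[where g = "\<lambda>k. v k (u k m)"]) (auto intro!: u' v' that)
    ultimately show ?lhs by (intro split_imp_iso_direct_summand[OF M Q])
  qed
qed


subsection \<open>Tensor products of bimodules\<close>

lemma abelian_group_hom_compose:
  assumes "abelian_group_hom G H f" "abelian_group_hom H K g"
  shows "abelian_group_hom G K (\<lambda>x. g (f x))"
proof -
  interpret f: abelian_group_hom G H f by fact
  interpret g: abelian_group_hom H K g by fact
  show ?thesis
    by (rule abelian_group_homI') (auto simp: f.G.abelian_group_axioms g.H.abelian_group_axioms)
qed

lemma abelian_group_hom_add:
  assumes "abelian_group_hom G H f" "abelian_group_hom G H g"
  shows "abelian_group_hom G H (\<lambda>x. f x \<oplus>\<^bsub>H\<^esub> g x)"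
proof -
  interpret f: abelian_group_hom G H f by fact
  interpret g: abelian_group_hom G H g by fact
  show ?thesis
    by (rule abelian_group_homI')
      (auto simp: f.G.abelian_group_axioms f.H.abelian_group_axioms f.H.a_ac)
qed

lemma abelian_group_hom_id: "abelian_group G \<Longrightarrow> abelian_group_hom G G (\<lambda>x. x)"
  by (rule abelian_group_homI') auto

text \<open>The class of a free generator in the quotient, that is, the elementary tensor of
  \<open>x\<close> and \<open>y\<close>.\<close>

definition pure_tensor ::
  "('s, 'x) ring_scheme \<Rightarrow> ('m, 's, 'y) rmod_scheme \<Rightarrow> ('s, 'n, 't, 'z) bimod_scheme \<Rightarrow>
    'm \<Rightarrow> 'n \<Rightarrow> ('m \<times> 'n \<Rightarrow>\<^sub>0 int) set"
  where "pure_tensor S M N x y = tensor_kernel S M N #>\<^bsub>tensor_gens M N\<^esub> frag_of (x, y)"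

text \<open>The tower uses this with \<open>C\<close>, \<open>B\<close>, \<open>A\<close> for
  \<open>R\<close>, \<open>S\<close>, \<open>T\<close> and with two bimodule structures on the ring
  \<open>A\<close> for \<open>M\<close> and \<open>N\<close>.\<close>

locale bimodule_pair = LM: bimodule R M S + RN: bimodule S N T
  for R :: "('r, 'w) ring_scheme" and M :: "('r, 'm, 's, 'y) bimod_scheme"
    and S :: "('s, 'x) ring_scheme" and N :: "('s, 'n, 't, 'z) bimod_scheme"
    and T :: "('t, 'v) ring_scheme"
begin

abbreviation "F \<equiv> tensor_gens M N"
abbreviation "K \<equiv> tensor_kernel S M N"
abbreviation "MN \<equiv> bimod_tensor S M N"
abbreviation "pt \<equiv> pure_tensor S M N"

sublocale F: comm_group F by (rule abelian_free_Abelian_group)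

lemma frag_diff_closed: "\<lbrakk>a \<in> carrier F; b \<in> carrier F\<rbrakk> \<Longrightarrow> a - b \<in> carrier F"
  by (simp add: order_trans[OF keys_diff])

lemma frag_add_closed: "\<lbrakk>a \<in> carrier F; b \<in> carrier F\<rbrakk> \<Longrightarrow> a + b \<in> carrier F"
  using F.m_closed by (simp only: mult_free_Abelian_group)

lemma tensor_relators_closed: "tensor_relators S M N \<subseteq> carrier F"
  unfolding tensor_relators_def
  by (auto simp del: carrier_free_Abelian_group_iff intro!: frag_diff_closed frag_add_closed
      simp: LM.rsm_closed RN.lsm_closed)

lemma subgroup_tensor_kernel: "subgroup K F"
  unfolding tensor_kernel_def by (rule F.generate_is_subgroup[OF tensor_relators_closed])

sublocale K: normal K F
  by (rule F.subgroup_imp_normal[OF subgroup_tensor_kernel])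

lemma tensor_relators_subset_kernel: "tensor_relators S M N \<subseteq> K"
  unfolding tensor_kernel_def by (auto intro: generate.incl)

lemma relator_in_kernel:
  "\<lbrakk>x \<in> carrier M; x' \<in> carrier M; y \<in> carrier N\<rbrakk> \<Longrightarrow>
    frag_of (x \<oplus>\<^bsub>M\<^esub> x', y) - (frag_of (x, y) + frag_of (x', y)) \<in> K"
  "\<lbrakk>x \<in> carrier M; y \<in> carrier N; y' \<in> carrier N\<rbrakk> \<Longrightarrow>
    frag_of (x, y \<oplus>\<^bsub>N\<^esub> y') - (frag_of (x, y) + frag_of (x, y')) \<in> K"
  "\<lbrakk>x \<in> carrier M; s \<in> carrier S; y \<in> carrier N\<rbrakk> \<Longrightarrow>
    frag_of (x \<triangleleft>\<^bsub>M\<^esub> s, y) - frag_of (x, s \<triangleright>\<^bsub>N\<^esub> y) \<in> K"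
  by (rule subsetD[OF tensor_relators_subset_kernel]; unfold tensor_relators_def; blast)+

text \<open>The group operation of \<open>F\<close> is addition of formal sums, and
  \<open>a = (a - b) + b\<close> exhibits \<open>a\<close> as a member of the coset of
  \<open>b\<close>.\<close>

lemma coset_eqI:
  assumes "a \<in> carrier F" "b \<in> carrier F" "a - b \<in> K"
  shows "K #>\<^bsub>F\<^esub> a = K #>\<^bsub>F\<^esub> b"
proof -
  have "a \<in> K #>\<^bsub>F\<^esub> b"
    using F.rcosI[OF assms(3) K.subset assms(2)] by simp
  then show ?thesis using F.repr_independence[OF _ assms(2) subgroup_tensor_kernel] by simp
qed

lemma carrier_bimod_tensor: "carrier MN = (\<lambda>w. K #>\<^bsub>F\<^esub> w) ` carrier F"
  by (simp add: bimod_tensor_def Let_def carrier_FactGroup)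

lemma abelian_group_bimod_tensor: "abelian_group MN"
proof -
  interpret Q: comm_group "F Mod K" by (rule F.abelian_FactGroup[OF subgroup_tensor_kernel])
  have MN: "carrier MN = carrier (F Mod K)" "add MN = monoid.mult (F Mod K)" "\<zero>\<^bsub>MN\<^esub> = \<one>\<^bsub>F Mod K\<^esub>"
    by (simp_all add: bimod_tensor_def Let_def)
  show ?thesis
    by (rule abelian_groupI; unfold MN;
      rule Q.m_closed Q.one_closed Q.m_assoc Q.m_comm Q.l_one Q.l_inv_ex; assumption)
qed

sublocale MN: abelian_group MN by (rule abelian_group_bimod_tensor)

lemma coset_add:
  "\<lbrakk>a \<in> carrier F; b \<in> carrier F\<rbrakk> \<Longrightarrow>
    (K #>\<^bsub>F\<^esub> a) \<oplus>\<^bsub>MN\<^esub> (K #>\<^bsub>F\<^esub> b) = K #>\<^bsub>F\<^esub> (a + b)"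
  using K.rcos_sum[of a b] by (simp add: bimod_tensor_def Let_def)

lemma coset_zero: "K #>\<^bsub>F\<^esub> 0 = \<zero>\<^bsub>MN\<^esub>"
  using F.coset_join2[OF F.one_closed subgroup_tensor_kernel K.one_closed]
  by (simp add: bimod_tensor_def Let_def)

lemma pure_tensor_closed: "\<lbrakk>x \<in> carrier M; y \<in> carrier N\<rbrakk> \<Longrightarrow> pt x y \<in> carrier MN"
  by (auto simp: pure_tensor_def carrier_bimod_tensor)

lemma pure_tensor_add_left:
  assumes "x \<in> carrier M" "x' \<in> carrier M" "y \<in> carrier N"
  shows "pt (x \<oplus>\<^bsub>M\<^esub> x') y = pt x y \<oplus>\<^bsub>MN\<^esub> pt x' y"
proof -
  have c: "frag_of (x, y) \<in> carrier F" "frag_of (x', y) \<in> carrier F" "frag_of (x \<oplus>\<^bsub>M\<^esub> x', y) \<in> carrier F"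
    using assms by auto
  show ?thesis
    unfolding pure_tensor_def coset_add[OF c(1,2)]
    by (rule coset_eqI[OF c(3) frag_add_closed[OF c(1,2)] relator_in_kernel(1)[OF assms]])
qed

lemma pure_tensor_add_right:
  assumes "x \<in> carrier M" "y \<in> carrier N" "y' \<in> carrier N"
  shows "pt x (y \<oplus>\<^bsub>N\<^esub> y') = pt x y \<oplus>\<^bsub>MN\<^esub> pt x y'"
proof -
  have c: "frag_of (x, y) \<in> carrier F" "frag_of (x, y') \<in> carrier F" "frag_of (x, y \<oplus>\<^bsub>N\<^esub> y') \<in> carrier F"
    using assms by auto
  show ?thesis
    unfolding pure_tensor_def coset_add[OF c(1,2)]
    by (rule coset_eqI[OF c(3) frag_add_closed[OF c(1,2)] relator_in_kernel(2)[OF assms]])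
qed

lemma pure_tensor_balanced:
  assumes "x \<in> carrier M" "s \<in> carrier S" "y \<in> carrier N"
  shows "pt (x \<triangleleft>\<^bsub>M\<^esub> s) y = pt x (s \<triangleright>\<^bsub>N\<^esub> y)"
  unfolding pure_tensor_def
  by (rule coset_eqI[OF _ _ relator_in_kernel(3)[OF assms]])
    (use assms in \<open>auto simp: LM.rsm_closed RN.lsm_closed\<close>)

lemma pure_tensor_left_hom: "y \<in> carrier N \<Longrightarrow> abelian_group_hom M MN (\<lambda>x. pt x y)"
  by (rule abelian_group_homI')
    (auto simp: pure_tensor_closed pure_tensor_add_left LM.M.abelian_group_axioms MN.abelian_group_axioms)

lemma pure_tensor_right_hom: "x \<in> carrier M \<Longrightarrow> abelian_group_hom N MN (\<lambda>y. pt x y)"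
  by (rule abelian_group_homI')
    (auto simp: pure_tensor_closed pure_tensor_add_right RN.M.abelian_group_axioms MN.abelian_group_axioms)

text \<open>Cosets of free generators generate the quotient, so additive maps are determined by
  their values on pure tensors. Almost every later identity in a tensor product is reduced to pure
  tensors in this way.\<close>

lemma tensor_hom_eqI:
  assumes f: "abelian_group_hom MN G f" and g: "abelian_group_hom MN G g"
    and eq: "\<And>x y. x \<in> carrier M \<Longrightarrow> y \<in> carrier N \<Longrightarrow> f (pt x y) = g (pt x y)"
    and z: "z \<in> carrier MN"
  shows "f z = g z"
proof -
  interpret f: abelian_group_hom MN G f by fact
  interpret g: abelian_group_hom MN G g by fact
  obtain w where w: "w \<in> carrier F" "z = K #>\<^bsub>F\<^esub> w" using z by (auto simp: carrier_bimod_tensor)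
  have c: "K #>\<^bsub>F\<^esub> v \<in> carrier MN" if "v \<in> carrier F" for v
    using that by (auto simp: carrier_bimod_tensor)
  have "f (K #>\<^bsub>F\<^esub> w) = g (K #>\<^bsub>F\<^esub> w)"
    using w(1) unfolding carrier_free_Abelian_group_iff
  proof (induction w rule: free_Abelian_group_induct[consumes 1, case_names zero diff of])
    case zero
    then show ?case by (simp add: coset_zero)
  next
    case (diff a b)
    then have ab: "a \<in> carrier F" "b \<in> carrier F" by auto
    note ab' = frag_diff_closed[OF ab]
    \<comment> \<open>The induction builds elements by differences, whereas \<open>coset_add\<close>
      speaks of sums. Hence \<open>b\<close> is added back and then cancelled.\<close>
    have "f (K #>\<^bsub>F\<^esub> (a - b)) \<oplus>\<^bsub>G\<^esub> f (K #>\<^bsub>F\<^esub> b) = f (K #>\<^bsub>F\<^esub> a)"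
      using ab ab' by (simp del: carrier_free_Abelian_group_iff flip: f.hom_add add: c coset_add)
    moreover have "g (K #>\<^bsub>F\<^esub> (a - b)) \<oplus>\<^bsub>G\<^esub> g (K #>\<^bsub>F\<^esub> b) = g (K #>\<^bsub>F\<^esub> a)"
      using ab ab' by (simp del: carrier_free_Abelian_group_iff flip: g.hom_add add: c coset_add)
    ultimately have "f (K #>\<^bsub>F\<^esub> (a - b)) \<oplus>\<^bsub>G\<^esub> f (K #>\<^bsub>F\<^esub> b) = g (K #>\<^bsub>F\<^esub> (a - b)) \<oplus>\<^bsub>G\<^esub> f (K #>\<^bsub>F\<^esub> b)"
      using diff by simp
    then show ?case
      using f.H.add.right_cancel f.hom_closed g.hom_closed c ab ab' by metis
  next
    case (of p)
    then show ?case using eq by (cases p) (simp add: pure_tensor_def)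
  qed
  then show ?thesis using w by simp
qed

text \<open>Freeness of \<open>F\<close> extends \<open>\<phi>\<close> to an additive map.
  Biadditivity and balancedness put the relators into its kernel, so it factors through the quotient
  by the subgroup they generate.\<close>

lemma tensor_universal:
  assumes G: "abelian_group G"
    and closed: "\<And>x y. x \<in> carrier M \<Longrightarrow> y \<in> carrier N \<Longrightarrow> \<phi> x y \<in> carrier G"
    and addl: "\<And>x x' y. \<lbrakk>x \<in> carrier M; x' \<in> carrier M; y \<in> carrier N\<rbrakk> \<Longrightarrow>
      \<phi> (x \<oplus>\<^bsub>M\<^esub> x') y = \<phi> x y \<oplus>\<^bsub>G\<^esub> \<phi> x' y"
    and addr: "\<And>x y y'. \<lbrakk>x \<in> carrier M; y \<in> carrier N; y' \<in> carrier N\<rbrakk> \<Longrightarrow>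
      \<phi> x (y \<oplus>\<^bsub>N\<^esub> y') = \<phi> x y \<oplus>\<^bsub>G\<^esub> \<phi> x y'"
    and bal: "\<And>x s y. \<lbrakk>x \<in> carrier M; s \<in> carrier S; y \<in> carrier N\<rbrakk> \<Longrightarrow>
      \<phi> (x \<triangleleft>\<^bsub>M\<^esub> s) y = \<phi> x (s \<triangleright>\<^bsub>N\<^esub> y)"
  obtains h where "abelian_group_hom MN G h"
    "\<And>x y. x \<in> carrier M \<Longrightarrow> y \<in> carrier N \<Longrightarrow> h (pt x y) = \<phi> x y"
proof -
  interpret G: abelian_group G by fact
  obtain h where h: "h \<in> hom F (add_monoid G)"
    and h_of: "\<And>p. p \<in> carrier M \<times> carrier N \<Longrightarrow> h (frag_of p) = case_prod \<phi> p"
  proof -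
    have "case_prod \<phi> ` (carrier M \<times> carrier N) \<subseteq> carrier (add_monoid G)" using closed by auto
    then show thesis
      using comm_group.free_Abelian_group_universal[OF G.a_comm_group] that by blast
  qed
  interpret h: group_hom F "add_monoid G" h
    by (intro group_hom.intro group_hom_axioms.intro F.is_group G.a_group h)
  have h_add: "h (a + b) = h a \<oplus>\<^bsub>G\<^esub> h b" if "a \<in> carrier F" "b \<in> carrier F" for a b
    using h.hom_mult[OF that] by simp
  \<comment> \<open>Every relator is a difference, so it vanishes under \<open>h\<close> as soon as
    \<open>h\<close> agrees on its two terms.\<close>
  have h_diff: "h (a - b) = \<zero>\<^bsub>G\<^esub>" if "a \<in> carrier F" "b \<in> carrier F" "h a = h b" for a b
  proof -
    have "h (a - b) \<oplus>\<^bsub>G\<^esub> h b = \<zero>\<^bsub>G\<^esub> \<oplus>\<^bsub>G\<^esub> h b"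
      using h_add[OF frag_diff_closed[OF that(1,2)] that(2)] that h.hom_closed[OF that(2)] by simp
    then show ?thesis
      using G.add.right_cancel h.hom_closed that frag_diff_closed[OF that(1,2)] by (metis G.zero_closed partial_object.simps(1))
  qed
  have "h \<rho> = \<zero>\<^bsub>G\<^esub>" if "\<rho> \<in> tensor_relators S M N" for \<rho>
    using that unfolding tensor_relators_def
    by (auto simp: h_add h_of addl addr bal LM.rsm_closed RN.lsm_closed frag_add_closed
        simp del: carrier_free_Abelian_group_iff intro!: h_diff)
  then have "tensor_relators S M N \<subseteq> kernel F (add_monoid G) h"
    using tensor_relators_closed unfolding kernel_def
    by (auto simp del: carrier_free_Abelian_group_iff)
  then have "K \<subseteq> kernel F (add_monoid G) h"
    unfolding tensor_kernel_def by (rule F.generate_subgroup_incl[OF _ h.subgroup_kernel])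
  then obtain g where g: "g \<in> hom (F Mod K) (add_monoid G)"
    and gh: "\<And>w. w \<in> carrier F \<Longrightarrow> g (K #>\<^bsub>F\<^esub> w) = h w"
    using h.FactGroup_universal_kernel[OF K.normal_axioms] by blast
  have "abelian_group_hom MN G g"
    using g
    by (intro abelian_group_homI' MN.abelian_group_axioms G) (auto simp: hom_def bimod_tensor_def Let_def)
  moreover have "g (pt x y) = \<phi> x y" if "x \<in> carrier M" "y \<in> carrier N" for x y
    using that by (simp add: pure_tensor_def gh h_of)
  ultimately show thesis using that by blast
qed

section \<open>Scalar actions on the tensor product\<close>

lemma frag_extend_closed:
  assumes b: "\<And>p. p \<in> carrier M \<times> carrier N \<Longrightarrow> b p \<in> carrier F" and v: "v \<in> carrier F"
  shows "frag_extend b v \<in> carrier F"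
proof -
  have "Poly_Mapping.keys (b p) \<subseteq> carrier M \<times> carrier N" if "p \<in> Poly_Mapping.keys v" for p
    using b[of p] v that by (simp only: carrier_free_Abelian_group_iff) blast
  then show ?thesis
    unfolding carrier_free_Abelian_group_iff by (intro order_trans[OF keys_frag_extend] UN_least)
qed

text \<open>An additive map sending relators into \<open>K\<close> sends all of \<open>K\<close>
  into \<open>K\<close>. The image of a coset then lies in a single coset, and adding
  \<open>K\<close> fills that coset. This shows that the scalar actions do not depend on
  representatives.\<close>

lemma frag_extend_coset:
  assumes b: "\<And>p. p \<in> carrier M \<times> carrier N \<Longrightarrow> b p \<in> carrier F"
    and rel: "frag_extend b ` tensor_relators S M N \<subseteq> K"
    and w: "w \<in> carrier F"
  shows "K <#>\<^bsub>F\<^esub> frag_extend b ` (K #>\<^bsub>F\<^esub> w) = K #>\<^bsub>F\<^esub> frag_extend b w"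
proof -
  note cl = frag_extend_closed[OF b]
  interpret b: group_hom F F "frag_extend b"
    by unfold_locales (auto simp: hom_def frag_extend_add cl simp del: carrier_free_Abelian_group_iff)
  have "frag_extend b ` K \<subseteq> generate F (frag_extend b ` tensor_relators S M N)"
    unfolding tensor_kernel_def using b.generate_img[OF tensor_relators_closed] by simp
  also have "\<dots> \<subseteq> K" by (rule F.generate_subgroup_incl[OF rel subgroup_tensor_kernel])
  finally have bK: "frag_extend b k \<in> K" if "k \<in> K" for k using that by blast
  have K0: "0 \<in> K" using K.one_closed by simp
  have Kp: "k + k' \<in> K" if "k \<in> K" "k' \<in> K" for k k' using K.m_closed[OF that] by simp
  show ?thesis
  proof (intro equalityI subsetI)
    fix v assume "v \<in> K <#>\<^bsub>F\<^esub> frag_extend b ` (K #>\<^bsub>F\<^esub> w)"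
    then obtain k k' where "k \<in> K" "k' \<in> K" "v = k + frag_extend b (k' + w)"
      by (auto simp: set_mult_def r_coset_def)
    then have "v = (k + frag_extend b k') + frag_extend b w" "k + frag_extend b k' \<in> K"
      by (auto simp: frag_extend_add Kp bK)
    then show "v \<in> K #>\<^bsub>F\<^esub> frag_extend b w" by (auto simp: r_coset_def)
  next
    fix v assume "v \<in> K #>\<^bsub>F\<^esub> frag_extend b w"
    \<comment> \<open>Writing \<open>w\<close> as \<open>0 + w\<close> displays it as a member of
      its own coset.\<close>
    then obtain k where "k \<in> K" "v = k + frag_extend b (0 + w)" by (auto simp: r_coset_def)
    then show "v \<in> K <#>\<^bsub>F\<^esub> frag_extend b ` (K #>\<^bsub>F\<^esub> w)"
      using K0 by (force simp: set_mult_def r_coset_def)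
  qed
qed

lemma frag_extend_coset_hom:
  assumes b: "\<And>p. p \<in> carrier M \<times> carrier N \<Longrightarrow> b p \<in> carrier F"
    and rel: "frag_extend b ` tensor_relators S M N \<subseteq> K"
  shows "abelian_group_hom MN MN (\<lambda>X. K <#>\<^bsub>F\<^esub> frag_extend b ` X)"
proof -
  note cl = frag_extend_closed[OF b]
  show ?thesis
  proof (rule abelian_group_homI'[OF MN.abelian_group_axioms MN.abelian_group_axioms])
    show "(\<lambda>X. K <#>\<^bsub>F\<^esub> frag_extend b ` X) \<in> carrier MN \<rightarrow> carrier MN"
      using cl frag_extend_coset[OF b rel] by (auto simp: carrier_bimod_tensor simp del: carrier_free_Abelian_group_iff)
    fix X Y assume "X \<in> carrier MN" "Y \<in> carrier MN"
    then obtain v w where "v \<in> carrier F" "w \<in> carrier F" "X = K #>\<^bsub>F\<^esub> v" "Y = K #>\<^bsub>F\<^esub> w"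
      by (auto simp: carrier_bimod_tensor)
    then show "K <#>\<^bsub>F\<^esub> frag_extend b ` (X \<oplus>\<^bsub>MN\<^esub> Y) =
        (K <#>\<^bsub>F\<^esub> frag_extend b ` X) \<oplus>\<^bsub>MN\<^esub> (K <#>\<^bsub>F\<^esub> frag_extend b ` Y)"
      by (simp only: coset_add frag_extend_coset[OF b rel] frag_add_closed cl frag_extend_add)
  qed
qed

text \<open>Each relator is sent to a relator of the same kind; for the balancing relators this is
  the compatibility \<open>LM.lsm_rsm\<close> of the two actions on \<open>M\<close>.\<close>

lemma frag_extend_lsm:
  assumes "r \<in> carrier R"
  shows "frag_extend (\<lambda>(x, y). frag_of (r \<triangleright>\<^bsub>M\<^esub> x, y)) ` tensor_relators S M N \<subseteq> K"
  using assms
  by (auto simp: frag_extend_diff frag_extend_add tensor_relators_def LM.lsm_add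
      LM.lsm_closed intro!: relator_in_kernel simp flip: LM.lsm_rsm)

text \<open>The mirror image, with the compatibility \<open>RN.lsm_rsm\<close> of the two actions on
  \<open>N\<close>.\<close>

lemma frag_extend_rsm:
  assumes "t \<in> carrier T"
  shows "frag_extend (\<lambda>(x, y). frag_of (x, y \<triangleleft>\<^bsub>N\<^esub> t)) ` tensor_relators S M N \<subseteq> K"
  using assms
  by (auto simp: frag_extend_diff frag_extend_add tensor_relators_def RN.rsm_add RN.lsm_rsm
      RN.rsm_closed intro!: relator_in_kernel)

lemma bimod_tensor_lsm:
  "r \<triangleright>\<^bsub>MN\<^esub> X = K <#>\<^bsub>F\<^esub> frag_extend (\<lambda>(x, y). frag_of (r \<triangleright>\<^bsub>M\<^esub> x, y)) ` X"
  by (simp add: bimod_tensor_def Let_def)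

lemma bimod_tensor_rsm:
  "X \<triangleleft>\<^bsub>MN\<^esub> t = K <#>\<^bsub>F\<^esub> frag_extend (\<lambda>(x, y). frag_of (x, y \<triangleleft>\<^bsub>N\<^esub> t)) ` X"
  by (simp add: bimod_tensor_def Let_def)

lemma bimod_tensor_lsm_hom: "r \<in> carrier R \<Longrightarrow> abelian_group_hom MN MN (\<lambda>X. r \<triangleright>\<^bsub>MN\<^esub> X)"
  unfolding bimod_tensor_lsm
  by (rule frag_extend_coset_hom) (auto simp: frag_extend_lsm LM.lsm_closed)

lemma bimod_tensor_rsm_hom: "t \<in> carrier T \<Longrightarrow> abelian_group_hom MN MN (\<lambda>X. X \<triangleleft>\<^bsub>MN\<^esub> t)"
  unfolding bimod_tensor_rsm
  by (rule frag_extend_coset_hom) (auto simp: frag_extend_rsm RN.rsm_closed)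

lemma lsm_pure_tensor:
  "\<lbrakk>r \<in> carrier R; x \<in> carrier M; y \<in> carrier N\<rbrakk> \<Longrightarrow> r \<triangleright>\<^bsub>MN\<^esub> pt x y = pt (r \<triangleright>\<^bsub>M\<^esub> x) y"
  unfolding bimod_tensor_lsm pure_tensor_def
  by (subst frag_extend_coset) (auto simp: frag_extend_lsm LM.lsm_closed)

lemma rsm_pure_tensor:
  "\<lbrakk>t \<in> carrier T; x \<in> carrier M; y \<in> carrier N\<rbrakk> \<Longrightarrow> pt x y \<triangleleft>\<^bsub>MN\<^esub> t = pt x (y \<triangleleft>\<^bsub>N\<^esub> t)"
  unfolding bimod_tensor_rsm pure_tensor_def
  by (subst frag_extend_coset) (auto simp: frag_extend_rsm RN.rsm_closed)

text \<open>Closure and additivity in the tensor come from the actions being homomorphisms. Each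
  remaining law, for fixed scalars, equates two additive maps built from the actions by composition
  and addition, so pure tensors suffice.\<close>

lemma bimodule_bimod_tensor: "bimodule R MN T"
proof -
  note homs = bimod_tensor_lsm_hom bimod_tensor_rsm_hom abelian_group_hom_id[OF MN.abelian_group_axioms]
    abelian_group_hom_compose[OF bimod_tensor_lsm_hom bimod_tensor_lsm_hom]
    abelian_group_hom_compose[OF bimod_tensor_rsm_hom bimod_tensor_rsm_hom]
    abelian_group_hom_compose[OF bimod_tensor_lsm_hom bimod_tensor_rsm_hom]
    abelian_group_hom_compose[OF bimod_tensor_rsm_hom bimod_tensor_lsm_hom]
    abelian_group_hom_add[OF bimod_tensor_lsm_hom bimod_tensor_lsm_hom]
    abelian_group_hom_add[OF bimod_tensor_rsm_hom bimod_tensor_rsm_hom]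
  note pure = lsm_pure_tensor rsm_pure_tensor pure_tensor_closed LM.lsm_closed RN.rsm_closed
    LM.lsm_add_scalar RN.rsm_add_scalar pure_tensor_add_left pure_tensor_add_right LM.lsm_mult
    RN.rsm_mult LM.lsm_one RN.rsm_one
  note lhom = bimod_tensor_lsm_hom[THEN abelian_group_hom.hom_closed]
    bimod_tensor_lsm_hom[THEN abelian_group_hom.hom_add]
  note rhom = bimod_tensor_rsm_hom[THEN abelian_group_hom.hom_closed]
    bimod_tensor_rsm_hom[THEN abelian_group_hom.hom_add]
  show ?thesis
    apply (intro bimodule.intro right_module.intro bimodule_axioms.intro right_module_axioms.intro
        LM.R.ring_axioms RN.S.ring_axioms MN.abelian_group_axioms)
              apply (simp_all only: lhom rhom)
           apply (rule tensor_hom_eqI; (rule homs | assumption | simp add: pure); simp)+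
    done
qed

end


subsection \<open>Dual bases\<close>

text \<open>Projectivity lifts the identity of \<open>M\<close> through the surjection from the free
  module on a finite generating set. The coordinates of the resulting splitting are the dual
  functionals \<open>\<phi> g\<close>.\<close>

lemma finite_projective_dual_basis:
  fixes S :: "('s, 'x) ring_scheme" and M :: "('m, 's, 'y) rmod_scheme"
  assumes "right_module S M" and fg: "finitely_generated S M" and proj: "projective S M"
  obtains G \<phi> where "finite G" "G \<subseteq> carrier M"
    "\<And>g m. g \<in> G \<Longrightarrow> m \<in> carrier M \<Longrightarrow> \<phi> g m \<in> carrier S"
    "\<And>g m n. g \<in> G \<Longrightarrow> m \<in> carrier M \<Longrightarrow> n \<in> carrier M \<Longrightarrow> \<phi> g (m \<oplus>\<^bsub>M\<^esub> n) = \<phi> g m \<oplus>\<^bsub>S\<^esub> \<phi> g n"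
    "\<And>g m s. g \<in> G \<Longrightarrow> m \<in> carrier M \<Longrightarrow> s \<in> carrier S \<Longrightarrow> \<phi> g (m \<triangleleft>\<^bsub>M\<^esub> s) = \<phi> g m \<otimes>\<^bsub>S\<^esub> s"
    "\<And>m. m \<in> carrier M \<Longrightarrow> (\<Oplus>\<^bsub>M\<^esub>g\<in>G. g \<triangleleft>\<^bsub>M\<^esub> \<phi> g m) = m"
proof -
  interpret right_module S M by fact
  obtain G where G: "finite G" "G \<subseteq> carrier M"
    and gen: "\<And>m. m \<in> carrier M \<Longrightarrow> \<exists>c \<in> G \<rightarrow> carrier S. m = (\<Oplus>\<^bsub>M\<^esub>g\<in>G. g \<triangleleft>\<^bsub>M\<^esub> c g)"
    using fg unfolding finitely_generated_def by blast
  \<comment> \<open>The free right module on \<open>G\<close>, realised as functions on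
    \<open>G\<close> so that it has the type over which \<open>projective\<close>
    quantifies.\<close>
  define X :: "('m \<Rightarrow> 's, 's) rmod" where "X = \<lparr>carrier = G \<rightarrow>\<^sub>E carrier S, mult = undefined, one = undefined,
     ring.zero = (\<lambda>g\<in>G. \<zero>\<^bsub>S\<^esub>), add = (\<lambda>u v. \<lambda>g\<in>G. u g \<oplus>\<^bsub>S\<^esub> v g),
     rsm = (\<lambda>u s. \<lambda>g\<in>G. u g \<otimes>\<^bsub>S\<^esub> s)\<rparr>"
  have X [simp]: "carrier X = G \<rightarrow>\<^sub>E carrier S" "\<zero>\<^bsub>X\<^esub> = (\<lambda>g\<in>G. \<zero>\<^bsub>S\<^esub>)"
    "u \<oplus>\<^bsub>X\<^esub> v = (\<lambda>g\<in>G. u g \<oplus>\<^bsub>S\<^esub> v g)" "u \<triangleleft>\<^bsub>X\<^esub> s = (\<lambda>g\<in>G. u g \<otimes>\<^bsub>S\<^esub> s)" for u v s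
    by (simp_all add: X_def)
  have "abelian_group X"
    apply (rule abelian_groupI)
    apply (auto simp: fun_eq_iff S.a_ac extensional_def PiE_iff)
    subgoal for x by (rule bexI[of _ "\<lambda>g\<in>G. \<ominus>\<^bsub>S\<^esub> x g"]) (auto simp: S.r_neg PiE_iff)
    done
  then have "right_module S X"
    by (intro right_module.intro right_module_axioms.intro S.ring_axioms)
      (auto simp: fun_eq_iff PiE_iff extensional_def S.l_distr S.r_distr S.m_assoc)
  \<comment> \<open>Truncation discards further record fields, such as a left action, so that
    \<open>M\<close> fits the type of the target in \<open>projective\<close>.\<close>
  moreover define Y where "Y = rmod.truncate M"
  have Y [simp]: "carrier Y = carrier M" "\<zero>\<^bsub>Y\<^esub> = \<zero>\<^bsub>M\<^esub>"
    "u \<oplus>\<^bsub>Y\<^esub> v = u \<oplus>\<^bsub>M\<^esub> v" "u \<triangleleft>\<^bsub>Y\<^esub> s = u \<triangleleft>\<^bsub>M\<^esub> s" for u v s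
    by (simp_all add: Y_def rmod.truncate_def)
  have "abelian_group Y"
    by (rule abelian_groupI) (auto simp: M.a_ac intro: M.add.l_inv_ex)
  then have "right_module S Y"
    by (intro right_module.intro right_module_axioms.intro S.ring_axioms)
      (auto simp: rsm_closed rsm_add rsm_add_scalar rsm_mult rsm_one)
  moreover define p where "p c = (\<Oplus>\<^bsub>M\<^esub>g\<in>G. g \<triangleleft>\<^bsub>M\<^esub> c g)" for c
  have cl: "(\<lambda>g. g \<triangleleft>\<^bsub>M\<^esub> c g) \<in> G \<rightarrow> carrier M" if "c \<in> G \<rightarrow>\<^sub>E carrier S" for c
    using that G by (auto intro!: rsm_closed)
  have "p \<in> rmod_hom S X Y"
    unfolding rmod_hom_def
  proof (intro CollectI conjI ballI)
    show "p \<in> carrier X \<rightarrow> carrier Y" using cl by (auto simp: p_def)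
    fix c assume c: "c \<in> carrier X"
    show "p (c \<oplus>\<^bsub>X\<^esub> d) = p c \<oplus>\<^bsub>Y\<^esub> p d" if d: "d \<in> carrier X" for d
    proof -
      have "p c \<oplus>\<^bsub>Y\<^esub> p d = (\<Oplus>\<^bsub>M\<^esub>g\<in>G. g \<triangleleft>\<^bsub>M\<^esub> c g \<oplus>\<^bsub>M\<^esub> g \<triangleleft>\<^bsub>M\<^esub> d g)"
        using c d cl by (simp add: p_def M.finsum_addf)
      also have "\<dots> = p (c \<oplus>\<^bsub>X\<^esub> d)"
        unfolding p_def using c d G
        by (intro M.finsum_cong') (auto simp: PiE_iff rsm_add_scalar subset_iff intro!: rsm_closed)
      finally show ?thesis by simp
    qed
    show "p (c \<triangleleft>\<^bsub>X\<^esub> s) = p c \<triangleleft>\<^bsub>Y\<^esub> s" if s: "s \<in> carrier S" for s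
    proof -
      have hom: "abelian_group_hom M M (\<lambda>m. m \<triangleleft>\<^bsub>M\<^esub> s)"
        by (rule abelian_group_homI') (simp_all add: rsm_closed rsm_add s M.abelian_group_axioms)
      have "p c \<triangleleft>\<^bsub>Y\<^esub> s = (\<Oplus>\<^bsub>M\<^esub>g\<in>G. (g \<triangleleft>\<^bsub>M\<^esub> c g) \<triangleleft>\<^bsub>M\<^esub> s)"
        using abelian_group_hom.hom_finsum[OF hom cl] c by (simp add: p_def)
      also have "\<dots> = p (c \<triangleleft>\<^bsub>X\<^esub> s)"
        unfolding p_def using c s G
        by (intro M.finsum_cong') (auto simp: PiE_iff rsm_mult subset_iff intro!: rsm_closed)
      finally show ?thesis by simp
    qed
  qed
  moreover have "p ` carrier X = carrier Y"
  proof
    show "p ` carrier X \<subseteq> carrier Y" using cl by (auto simp: p_def)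
    show "carrier Y \<subseteq> p ` carrier X"
    proof
      fix m assume "m \<in> carrier Y"
      then obtain c where c: "c \<in> G \<rightarrow> carrier S" "m = (\<Oplus>\<^bsub>M\<^esub>g\<in>G. g \<triangleleft>\<^bsub>M\<^esub> c g)" using gen by auto
      \<comment> \<open>The coefficients from \<open>gen\<close> may be arbitrary off
        \<open>G\<close>; restriction brings them into the extensional carrier of
        \<open>X\<close>.\<close>
      have "p (restrict c G) = m"
        unfolding p_def c(2) using c(1) G by (intro M.finsum_cong') (auto intro!: rsm_closed)
      with c show "m \<in> p ` carrier X" by (auto intro!: image_eqI[of _ _ "restrict c G"])
    qed
  qed
  moreover have "id \<in> rmod_hom S M Y" by (auto simp: rmod_hom_def)
  ultimately obtain h where h: "h \<in> rmod_hom S M X" and ph: "\<And>m. m \<in> carrier M \<Longrightarrow> p (h m) = m"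
    using proj[unfolded projective_def, rule_format, of X Y p id] by auto
  have hm: "h m \<in> G \<rightarrow>\<^sub>E carrier S" if "m \<in> carrier M" for m
    using h that by (auto simp: rmod_hom_def)
  show thesis
    by (rule that[of G "\<lambda>g m. h m g"])
      (use G h hm ph in \<open>auto simp: rmod_hom_def p_def PiE_iff\<close>)
qed


subsection \<open>Endomorphisms and the tensor square in a tower of rings\<close>

lemma ring_bimod_simps [simp]:
  "carrier (ring_bimod A f g) = carrier A"
  "\<zero>\<^bsub>ring_bimod A f g\<^esub> = \<zero>\<^bsub>A\<^esub>"
  "x \<oplus>\<^bsub>ring_bimod A f g\<^esub> y = x \<oplus>\<^bsub>A\<^esub> y"
  "x \<triangleleft>\<^bsub>ring_bimod A f g\<^esub> s = x \<otimes>\<^bsub>A\<^esub> g s"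
  "r \<triangleright>\<^bsub>ring_bimod A f g\<^esub> x = f r \<otimes>\<^bsub>A\<^esub> x"
  by (simp_all add: ring_bimod_def)

text \<open>\<open>finsum\<close> reads only the carrier, the addition and the zero, which
  \<open>ring_bimod\<close> copies from \<open>A\<close>. Sums in the bimodule can thus be exchanged
  for sums in the ring.\<close>

lemma finsum_ring_bimod: "finsum (ring_bimod A f g) h I = finsum A h I"
  by (simp add: finsum_def finprod_def ring_bimod_def)

lemma bimodule_ring_bimod:
  assumes "ring A" "ring R" "ring S" and f: "f \<in> ring_hom R A" and g: "g \<in> ring_hom S A"
  shows "bimodule R (ring_bimod A f g) S"
proof -
  interpret A: ring A by fact
  note f = f[THEN ring_hom_closed] f[THEN ring_hom_add] f[THEN ring_hom_mult] f[THEN ring_hom_one]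
  note g = g[THEN ring_hom_closed] g[THEN ring_hom_add] g[THEN ring_hom_mult] g[THEN ring_hom_one]
  have "abelian_group (ring_bimod A f g)"
    by (rule abelian_groupI) (auto simp: A.a_ac intro: A.add.l_inv_ex)
  then show ?thesis
    by (intro bimodule.intro right_module.intro bimodule_axioms.intro right_module_axioms.intro assms(2,3))
      (auto simp: f g A.l_distr A.r_distr A.m_assoc)
qed

lemma (in ring) id_ring_hom: "id \<in> ring_hom R R"
  by (auto simp: ring_hom_def)

lemma (in ring) mult_right_hom: "a \<in> carrier R \<Longrightarrow> abelian_group_hom R R (\<lambda>x. x \<otimes> a)"
  by (rule abelian_group_homI') (auto simp: l_distr abelian_group_axioms)

lemma (in ring) mult_left_hom: "a \<in> carrier R \<Longrightarrow> abelian_group_hom R R (\<lambda>x. a \<otimes> x)"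
  by (rule abelian_group_homI') (auto simp: r_distr abelian_group_axioms)

context ring_tower
begin

abbreviation "E \<equiv> End_bimod A B \<beta> \<gamma>"
abbreviation "AA \<equiv> bimod_tensor B (ring_bimod A (\<beta> \<circ> \<gamma>) \<beta>) (ring_bimod A \<beta> id)"
abbreviation "pt \<equiv> pure_tensor B (ring_bimod A (\<beta> \<circ> \<gamma>) \<beta>) (ring_bimod A \<beta> id)"

lemma hom_simps [simp]:
  "b \<in> carrier B \<Longrightarrow> \<beta> b \<in> carrier A"
  "c \<in> carrier C \<Longrightarrow> \<gamma> c \<in> carrier B"
  "b \<in> carrier B \<Longrightarrow> b' \<in> carrier B \<Longrightarrow> \<beta> (b \<oplus>\<^bsub>B\<^esub> b') = \<beta> b \<oplus> \<beta> b'"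
  "b \<in> carrier B \<Longrightarrow> b' \<in> carrier B \<Longrightarrow> \<beta> (b \<otimes>\<^bsub>B\<^esub> b') = \<beta> b \<otimes> \<beta> b'"
  "\<beta> \<one>\<^bsub>B\<^esub> = \<one>"
  "c \<in> carrier C \<Longrightarrow> c' \<in> carrier C \<Longrightarrow> \<gamma> (c \<oplus>\<^bsub>C\<^esub> c') = \<gamma> c \<oplus>\<^bsub>B\<^esub> \<gamma> c'"
  "c \<in> carrier C \<Longrightarrow> c' \<in> carrier C \<Longrightarrow> \<gamma> (c \<otimes>\<^bsub>C\<^esub> c') = \<gamma> c \<otimes>\<^bsub>B\<^esub> \<gamma> c'"
  "\<gamma> \<one>\<^bsub>C\<^esub> = \<one>\<^bsub>B\<^esub>"
  using beta_hom gamma_hom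
  by (auto simp: ring_hom_closed ring_hom_add ring_hom_mult ring_hom_one)

lemma composite_hom: "\<beta> \<circ> \<gamma> \<in> ring_hom C A"
  using gamma_hom beta_hom by (rule ring_hom_trans)

text \<open>In order: the two tensor factors, the bimodules whose powers occur on the two sides of
  the theorem, and the one whose right structure is \<open>A\<close> over \<open>B\<close>.\<close>

lemma bimodule_ring_bimods:
  "bimodule C (ring_bimod A (\<beta> \<circ> \<gamma>) \<beta>) B" "bimodule B (ring_bimod A \<beta> id) A"
  "bimodule C (ring_bimod A (\<beta> \<circ> \<gamma>) id) A" "bimodule A (ring_bimod A id (\<beta> \<circ> \<gamma>)) C"
  "bimodule A (ring_bimod A id \<beta>) B"
  by (intro bimodule_ring_bimod A.ring_axioms B.ring_axioms C.ring_axioms composite_hom beta_hom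
      A.id_ring_hom)+

sublocale T: bimodule_pair C "ring_bimod A (\<beta> \<circ> \<gamma>) \<beta>" B "ring_bimod A \<beta> id" A
  by (intro bimodule_pair.intro bimodule_ring_bimods)

lemma bimodule_AA: "bimodule C AA A"
  by (rule T.bimodule_bimod_tensor)

sublocale AA: bimodule C AA A by (rule bimodule_AA)

lemma End_simps [simp]:
  "\<zero>\<^bsub>E\<^esub> = (\<lambda>x\<in>carrier A. \<zero>)"
  "f \<oplus>\<^bsub>E\<^esub> g = (\<lambda>x\<in>carrier A. f x \<oplus> g x)"
  "f \<triangleleft>\<^bsub>E\<^esub> c = (\<lambda>x\<in>carrier A. f (\<beta> (\<gamma> c) \<otimes> x))"
  "a \<triangleright>\<^bsub>E\<^esub> f = (\<lambda>x\<in>carrier A. a \<otimes> f x)"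
  by (simp_all add: End_bimod_def)

lemma mem_End_iff: "f \<in> carrier E \<longleftrightarrow>
    (\<forall>x\<in>carrier A. f x \<in> carrier A) \<and>
    (\<forall>x\<in>carrier A. \<forall>y\<in>carrier A. f (x \<oplus> y) = f x \<oplus> f y) \<and>
    (\<forall>x\<in>carrier A. \<forall>b\<in>carrier B. f (x \<otimes> \<beta> b) = f x \<otimes> \<beta> b) \<and> f \<in> extensional (carrier A)"
  by (auto simp: End_bimod_def rmod_hom_def)

lemma EndD:
  assumes "f \<in> carrier E"
  shows "x \<in> carrier A \<Longrightarrow> f x \<in> carrier A"
    and "x \<in> carrier A \<Longrightarrow> y \<in> carrier A \<Longrightarrow> f (x \<oplus> y) = f x \<oplus> f y"
    and "x \<in> carrier A \<Longrightarrow> b \<in> carrier B \<Longrightarrow> f (x \<otimes> \<beta> b) = f x \<otimes> \<beta> b"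
    and "f \<in> extensional (carrier A)"
  using assms by (auto simp: mem_End_iff)

lemma End_eqI:
  "\<lbrakk>f \<in> carrier E; g \<in> carrier E; \<And>x. x \<in> carrier A \<Longrightarrow> f x = g x\<rbrakk> \<Longrightarrow> f = g"
  using EndD(4) extensionalityI by metis

text \<open>Left multiplications, applied before or after \<open>f\<close>, commute with right
  multiplication by \<open>B\<close>, so both actions preserve right
  \<open>B\<close>-linearity.\<close>

lemma bimodule_End: "bimodule A E C"
proof -
  have "abelian_group E"
  proof (rule abelian_groupI)
    fix f assume f: "f \<in> carrier E"
    have "(\<lambda>x\<in>carrier A. \<ominus> f x) \<in> carrier E"
      using f by (auto simp: mem_End_iff A.minus_add A.l_minus)
    moreover have "(\<lambda>x\<in>carrier A. \<ominus> f x) \<oplus>\<^bsub>E\<^esub> f = \<zero>\<^bsub>E\<^esub>"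
      using EndD[OF f] by (auto simp: A.l_neg fun_eq_iff)
    ultimately show "\<exists>g\<in>carrier E. g \<oplus>\<^bsub>E\<^esub> f = \<zero>\<^bsub>E\<^esub>" by blast
  qed (auto simp: mem_End_iff A.a_ac A.l_distr extensional_def fun_eq_iff)
  then show ?thesis
    apply (intro bimodule.intro right_module.intro bimodule_axioms.intro right_module_axioms.intro
        A.ring_axioms C.ring_axioms)
    apply (auto simp: mem_End_iff A.a_ac A.l_distr A.r_distr extensional_def fun_eq_iff A.m_assoc)
    apply (simp_all flip: A.m_assoc)
    done
qed

sublocale E: bimodule A E C by (rule bimodule_End)

section \<open>Evaluating endomorphisms at points and on tensors\<close>

lemma End_apply_hom: "x \<in> carrier A \<Longrightarrow> abelian_group_hom E A (\<lambda>f. f x)"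
  by (rule abelian_group_homI') (auto simp: E.M.abelian_group_axioms A.abelian_group_axioms EndD)

text \<open>The additive map taking the tensor of \<open>y\<close> and \<open>z\<close> to
  \<open>f y \<otimes> z\<close>. It is chosen by \<open>SOME\<close> because
  \<open>tensor_universal\<close> is an existence statement.\<close>

definition ev :: "('a \<Rightarrow> 'a) \<Rightarrow> ('a \<times> 'a \<Rightarrow>\<^sub>0 int) set \<Rightarrow> 'a"
  where "ev f = (SOME h. abelian_group_hom AA A h \<and>
    (\<forall>x\<in>carrier A. \<forall>y\<in>carrier A. h (pt x y) = f x \<otimes> y))"

text \<open>Right \<open>B\<close>-linearity of \<open>f\<close> is exactly what makes the map from
  \<open>x\<close> and \<open>y\<close> to \<open>f x \<otimes> y\<close> balanced.\<close>

lemma ev: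
  assumes f: "f \<in> carrier E"
  shows ev_hom: "abelian_group_hom AA A (ev f)"
    and ev_pure: "x \<in> carrier A \<Longrightarrow> y \<in> carrier A \<Longrightarrow> ev f (pt x y) = f x \<otimes> y"
proof -
  note f' = EndD[OF f]
  obtain h where "abelian_group_hom AA A h" "\<And>x y. x \<in> carrier A \<Longrightarrow> y \<in> carrier A \<Longrightarrow> h (pt x y) = f x \<otimes> y"
    by (rule T.tensor_universal[of A "\<lambda>x y. f x \<otimes> y"])
      (auto simp: f' A.abelian_group_axioms A.l_distr A.r_distr A.m_assoc)
  then have "\<exists>h. abelian_group_hom AA A h \<and>
    (\<forall>x\<in>carrier A. \<forall>y\<in>carrier A. h (pt x y) = f x \<otimes> y)" by blast
  from someI_ex[OF this] show "abelian_group_hom AA A (ev f)"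
    "x \<in> carrier A \<Longrightarrow> y \<in> carrier A \<Longrightarrow> ev f (pt x y) = f x \<otimes> y"
    unfolding ev_def by blast+
qed

lemmas ev_closed = abelian_group_hom.hom_closed[OF ev_hom]

lemma ev_rsm:
  assumes f: "f \<in> carrier E" and a: "a \<in> carrier A" and t: "t \<in> carrier AA"
  shows "ev f (t \<triangleleft>\<^bsub>AA\<^esub> a) = ev f t \<otimes> a"
  by (rule T.tensor_hom_eqI[OF abelian_group_hom_compose[OF AA.rsm_hom[OF a] ev_hom[OF f]]
        abelian_group_hom_compose[OF ev_hom[OF f] A.mult_right_hom[OF a]] _ t])
    (use f a in \<open>auto simp: T.rsm_pure_tensor ev_pure EndD A.m_assoc\<close>)

lemma ev_add:
  assumes f: "f \<in> carrier E" and g: "g \<in> carrier E" and t: "t \<in> carrier AA"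
  shows "ev (f \<oplus>\<^bsub>E\<^esub> g) t = ev f t \<oplus> ev g t"
proof -
  have fg: "f \<oplus>\<^bsub>E\<^esub> g \<in> carrier E" using f g by (rule E.M.a_closed)
  show ?thesis
    by (rule T.tensor_hom_eqI[OF ev_hom[OF fg] abelian_group_hom_add[OF ev_hom[OF f] ev_hom[OF g]] _ t])
      (use f g in \<open>auto simp: ev_pure[OF fg, simplified] ev_pure EndD A.l_distr\<close>)
qed

lemma ev_End_lsm:
  assumes f: "f \<in> carrier E" and a: "a \<in> carrier A" and t: "t \<in> carrier AA"
  shows "ev (a \<triangleright>\<^bsub>E\<^esub> f) t = a \<otimes> ev f t"
proof -
  have af: "a \<triangleright>\<^bsub>E\<^esub> f \<in> carrier E" using a f by (rule E.lsm_closed)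
  show ?thesis
    by (rule T.tensor_hom_eqI[OF ev_hom[OF af]
          abelian_group_hom_compose[OF ev_hom[OF f] A.mult_left_hom[OF a]] _ t])
      (use f a in \<open>auto simp: ev_pure[OF af, simplified] ev_pure EndD A.m_assoc\<close>)
qed

text \<open>Both sides multiply the first tensor factor by \<open>c\<close> on the left before
  applying \<open>f\<close>: the right action of \<open>C\<close> on \<open>E\<close> is adjoint to
  its left action on \<open>AA\<close>.\<close>

lemma ev_End_rsm:
  assumes f: "f \<in> carrier E" and c: "c \<in> carrier C" and t: "t \<in> carrier AA"
  shows "ev (f \<triangleleft>\<^bsub>E\<^esub> c) t = ev f (c \<triangleright>\<^bsub>AA\<^esub> t)"
proof -
  have fc: "f \<triangleleft>\<^bsub>E\<^esub> c \<in> carrier E" using f c by (rule E.rsm_closed)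
  show ?thesis
    by (rule T.tensor_hom_eqI[OF ev_hom[OF fc]
          abelian_group_hom_compose[OF AA.lsm_hom[OF c] ev_hom[OF f]] _ t])
      (use f c in \<open>auto simp: ev_pure[OF fc, simplified] ev_pure EndD T.lsm_pure_tensor\<close>)
qed

text \<open>The hypothesis on \<open>U\<close> says that acting on it by \<open>c\<close> from the
  right or by \<open>\<beta> (\<gamma> c)\<close> from the left gives the same endomorphism. This
  makes \<open>ev U\<close> left \<open>C\<close>-linear when \<open>U\<close> commutes with all of
  \<open>C\<close>.\<close>

lemma ev_lsm:
  assumes U: "U \<in> carrier E" and c: "c \<in> carrier C" and t: "t \<in> carrier AA"
    and Uc: "\<And>x. x \<in> carrier A \<Longrightarrow> U (\<beta> (\<gamma> c) \<otimes> x) = \<beta> (\<gamma> c) \<otimes> U x"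
  shows "ev U (c \<triangleright>\<^bsub>AA\<^esub> t) = \<beta> (\<gamma> c) \<otimes> ev U t"
proof -
  have "U \<triangleleft>\<^bsub>E\<^esub> c = \<beta> (\<gamma> c) \<triangleright>\<^bsub>E\<^esub> U" using Uc by (auto simp: fun_eq_iff)
  then show ?thesis
    using ev_End_rsm[OF U c t] ev_End_lsm[OF U _ t, of "\<beta> (\<gamma> c)"] c by simp
qed

section \<open>The two conditions as decompositions of the identity, and the passage between
  them\<close>

lemma left_depth_three_iff:
  "left_depth_three A B C \<beta> \<gamma> \<longleftrightarrow> (\<exists>n::nat>0. \<exists>u v.
    (\<forall>k<n. u k \<in> bimod_hom C A AA (ring_bimod A (\<beta> \<circ> \<gamma>) id)) \<and>
    (\<forall>k<n. v k \<in> bimod_hom C A (ring_bimod A (\<beta> \<circ> \<gamma>) id) AA) \<and>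
    (\<forall>z\<in>carrier AA. (\<Oplus>\<^bsub>AA\<^esub>k\<in>{..<n}. v k (u k z)) = z))"
  unfolding left_depth_three_def
  by (subst iso_direct_summand_power_iff[OF bimodule_AA bimodule_ring_bimods(3)]) simp

lemma End_direct_summand_iff:
  "iso_direct_summand A C E (bimod_power (ring_bimod A id (\<beta> \<circ> \<gamma>)) n) \<longleftrightarrow> (\<exists>u v.
    (\<forall>k<n. u k \<in> bimod_hom A C E (ring_bimod A id (\<beta> \<circ> \<gamma>))) \<and>
    (\<forall>k<n. v k \<in> bimod_hom A C (ring_bimod A id (\<beta> \<circ> \<gamma>)) E) \<and>
    (\<forall>f\<in>carrier E. (\<Oplus>\<^bsub>E\<^esub>k\<in>{..<n}. v k (u k f)) = f))"
  by (rule iso_direct_summand_power_iff[OF bimodule_End bimodule_ring_bimods(4)])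

text \<open>The quasibase consists of the values \<open>v k \<one>\<close> and of the maps from
  \<open>x\<close> to \<open>u k (pt x \<one>)\<close>. Evaluation on \<open>t k\<close> and
  multiplication of \<open>U k\<close> by elements of \<open>A\<close> then split
  \<open>E\<close>.\<close>

lemma left_depth_three_imp_End:
  assumes "left_depth_three A B C \<beta> \<gamma>"
  shows "\<exists>n>0. iso_direct_summand A C E (bimod_power (ring_bimod A id (\<beta> \<circ> \<gamma>)) n)"
proof -
  obtain n :: nat where ex: "n > 0 \<and> (\<exists>u v.
    (\<forall>k<n. u k \<in> bimod_hom C A AA (ring_bimod A (\<beta> \<circ> \<gamma>) id)) \<and>
    (\<forall>k<n. v k \<in> bimod_hom C A (ring_bimod A (\<beta> \<circ> \<gamma>) id) AA) \<and>
    (\<forall>z\<in>carrier AA. (\<Oplus>\<^bsub>AA\<^esub>k\<in>{..<n}. v k (u k z)) = z))"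
    using assms unfolding left_depth_three_iff by (rule exE)
  then have n: "n > 0" ..
  from ex obtain u v where
    *: "\<forall>k<n. u k \<in> bimod_hom C A AA (ring_bimod A (\<beta> \<circ> \<gamma>) id)"
      "\<forall>k<n. v k \<in> bimod_hom C A (ring_bimod A (\<beta> \<circ> \<gamma>) id) AA"
      "\<forall>z\<in>carrier AA. (\<Oplus>\<^bsub>AA\<^esub>k\<in>{..<n}. v k (u k z)) = z"
    by (elim conjE exE) (rule that)
  note u = *(1)[rule_format] and v = *(2)[rule_format] and sum = *(3)[rule_format]
  note u' = bimod_homD[OF u, unfolded ring_bimod_simps]
    and v' = bimod_homD[OF v, unfolded ring_bimod_simps]
  define t where "t k = v k \<one>" for k
  define U where "U k = (\<lambda>x\<in>carrier A. u k (pt x \<one>))" for k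
  have t: "t k \<in> carrier AA" if "k < n" for k using that by (simp add: t_def v')
  have vt: "v k a = t k \<triangleleft>\<^bsub>AA\<^esub> a" if "k < n" "a \<in> carrier A" for k a
    using v'(3)[OF that(1) A.one_closed that(2)] that by (simp add: t_def)
  \<comment> \<open>Both sides equal \<open>v k (\<beta> (\<gamma> c))\<close>, by right
    \<open>A\<close>-linearity and by left \<open>C\<close>-linearity respectively.\<close>
  have tc: "t k \<triangleleft>\<^bsub>AA\<^esub> \<beta> (\<gamma> c) = c \<triangleright>\<^bsub>AA\<^esub> t k" if "k < n" "c \<in> carrier C" for k c
    using v'(4)[OF that(1,2) A.one_closed] vt[OF that(1), of "\<beta> (\<gamma> c)"] that by (simp add: t_def)
  note pc = T.pure_tensor_closed[simplified]
  have U: "U k \<in> carrier E" if "k < n" for k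
  proof -
    \<comment> \<open>The scalar crosses the tensor sign and becomes a right action, which
      \<open>u k\<close> respects; hence \<open>U k\<close> is right
      \<open>B\<close>-linear.\<close>
    have "pt (x \<otimes> \<beta> b) \<one> = pt x \<one> \<triangleleft>\<^bsub>AA\<^esub> \<beta> b" if "x \<in> carrier A" "b \<in> carrier B" for x b
      using that T.pure_tensor_balanced[of x b \<one>] T.rsm_pure_tensor[of "\<beta> b" x \<one>] by simp
    then show ?thesis
      using that u' pc T.pure_tensor_add_left[simplified] by (auto simp: mem_End_iff U_def)
  qed
  have Uc: "U k (\<beta> (\<gamma> c) \<otimes> x) = \<beta> (\<gamma> c) \<otimes> U k x" if "k < n" "c \<in> carrier C" "x \<in> carrier A" for k c x
    using that u'(4)[OF that(1,2), of "pt x \<one>"] pc T.lsm_pure_tensor[of c x \<one>] by (simp add: U_def)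
  have "(\<lambda>f. ev f (t k)) \<in> bimod_hom A C E (ring_bimod A id (\<beta> \<circ> \<gamma>))" if k: "k < n" for k
  proof (rule bimod_homI)
    fix f assume f: "f \<in> carrier E"
    show "ev f (t k) \<in> carrier (ring_bimod A id (\<beta> \<circ> \<gamma>))" using f t k by (simp add: ev_closed)
    \<comment> \<open>The scalar \<open>c\<close> moves to the tensor \<open>t k\<close>, passes to
      its right side by centrality, and leaves as a right factor.\<close>
    show "ev (f \<triangleleft>\<^bsub>E\<^esub> c) (t k) = ev f (t k) \<triangleleft>\<^bsub>ring_bimod A id (\<beta> \<circ> \<gamma>)\<^esub> c" if "c \<in> carrier C" for c
      using f t k that by (simp only: ev_End_rsm ring_bimod_simps comp_apply)
        (simp only: ev_rsm hom_simps flip: tc)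
    show "ev (a \<triangleright>\<^bsub>E\<^esub> f) (t k) = a \<triangleright>\<^bsub>ring_bimod A id (\<beta> \<circ> \<gamma>)\<^esub> ev f (t k)" if "a \<in> carrier A" for a
      using f t k that by (simp only: ev_End_lsm ring_bimod_simps id_apply)
    show "ev (f \<oplus>\<^bsub>E\<^esub> g) (t k) = ev f (t k) \<oplus>\<^bsub>ring_bimod A id (\<beta> \<circ> \<gamma>)\<^esub> ev g (t k)" if "g \<in> carrier E" for g
      using f t k that by (simp only: ev_add ring_bimod_simps)
  qed
  moreover have "(\<lambda>a. a \<triangleright>\<^bsub>E\<^esub> U k) \<in> bimod_hom A C (ring_bimod A id (\<beta> \<circ> \<gamma>)) E" if k: "k < n" for k
  proof (rule bimod_homI)
    fix a assume "a \<in> carrier (ring_bimod A id (\<beta> \<circ> \<gamma>))"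
    then have a: "a \<in> carrier A" by simp
    show "a \<triangleright>\<^bsub>E\<^esub> U k \<in> carrier E" using a U[OF k] by (rule E.lsm_closed)
    show "(a \<triangleleft>\<^bsub>ring_bimod A id (\<beta> \<circ> \<gamma>)\<^esub> c) \<triangleright>\<^bsub>E\<^esub> U k = (a \<triangleright>\<^bsub>E\<^esub> U k) \<triangleleft>\<^bsub>E\<^esub> c" if "c \<in> carrier C" for c
      using a that k EndD[OF U[OF k]] by (auto simp: fun_eq_iff Uc A.m_assoc)
  qed (use U[OF k] in \<open>simp_all only: E.lsm_mult E.lsm_add_scalar ring_bimod_simps id_apply\<close>)
  moreover have "(\<Oplus>\<^bsub>E\<^esub>k\<in>{..<n}. ev f (t k) \<triangleright>\<^bsub>E\<^esub> U k) = f" if f: "f \<in> carrier E" for f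
  proof (rule End_eqI[OF _ f])
    have c: "(\<lambda>k. ev f (t k) \<triangleright>\<^bsub>E\<^esub> U k) \<in> {..<n} \<rightarrow> carrier E"
      using f t U by (auto intro!: E.lsm_closed ev_closed simp del: End_simps)
    then show "(\<Oplus>\<^bsub>E\<^esub>k\<in>{..<n}. ev f (t k) \<triangleright>\<^bsub>E\<^esub> U k) \<in> carrier E" by (rule E.M.finsum_closed)
    fix x assume x: "x \<in> carrier A"
    interpret f: abelian_group_hom AA A "ev f" using f by (rule ev_hom)
    have "(\<Oplus>\<^bsub>E\<^esub>k\<in>{..<n}. ev f (t k) \<triangleright>\<^bsub>E\<^esub> U k) x = (\<Oplus>k\<in>{..<n}. (ev f (t k) \<triangleright>\<^bsub>E\<^esub> U k) x)"
      using abelian_group_hom.hom_finsum[OF End_apply_hom[OF x] c] .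
    \<comment> \<open>\<open>ev f\<close> is right \<open>A\<close>-linear, so the factor
      \<open>U k x\<close> can be moved inside, where \<open>t k\<close> acted on by
      \<open>U k x\<close> is \<open>v k (U k x)\<close>.\<close>
    also have "\<dots> = (\<Oplus>k\<in>{..<n}. ev f (v k (u k (pt x \<one>))))"
      using f x t U by (intro A.finsum_cong') (auto simp: U_def vt u' pc ev_rsm AA.rsm_closed)
    also have "\<dots> = ev f (\<Oplus>\<^bsub>AA\<^esub>k\<in>{..<n}. v k (u k (pt x \<one>)))"
      by (rule f.hom_finsum[symmetric]) (use x pc in \<open>auto intro!: u' v'\<close>)
    also have "\<dots> = f x" using f x by (simp add: sum pc ev_pure EndD)
    finally show "(\<Oplus>\<^bsub>E\<^esub>k\<in>{..<n}. ev f (t k) \<triangleright>\<^bsub>E\<^esub> U k) x = f x" .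
  qed
  ultimately show ?thesis
    using n unfolding End_direct_summand_iff
    by (intro exI[of _ n] conjI exI[of _ "\<lambda>k f. ev f (t k)"] exI[of _ "\<lambda>k a. a \<triangleright>\<^bsub>E\<^esub> U k"]) auto
qed

text \<open>Finite generation and projectivity enter through a dual basis, whose functionals,
  composed with \<open>\<beta>\<close>, are endomorphisms to which the given decomposition applies.
  The maps splitting \<open>AA\<close> are \<open>ev (U k)\<close> and right multiplication of
  \<open>t k\<close>.\<close>

lemma End_imp_left_depth_three:
  assumes fg: "finitely_generated B (ring_bimod A id \<beta>)" and proj: "projective B (ring_bimod A id \<beta>)"
    and n: "n > 0" and sd: "iso_direct_summand A C E (bimod_power (ring_bimod A id (\<beta> \<circ> \<gamma>)) n)"
  shows "left_depth_three A B C \<beta> \<gamma>"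
proof -
  obtain p q where
    p: "\<And>k. k < n \<Longrightarrow> p k \<in> bimod_hom A C E (ring_bimod A id (\<beta> \<circ> \<gamma>))" and
    q: "\<And>k. k < n \<Longrightarrow> q k \<in> bimod_hom A C (ring_bimod A id (\<beta> \<circ> \<gamma>)) E" and
    sum: "\<And>f. f \<in> carrier E \<Longrightarrow> (\<Oplus>\<^bsub>E\<^esub>k\<in>{..<n}. q k (p k f)) = f"
    using sd unfolding End_direct_summand_iff by blast
  note p' = bimod_homD[OF p, simplified] and q' = bimod_homD[OF q, simplified]
  have "right_module B (ring_bimod A id \<beta>)" using bimodule_ring_bimods(5) by (simp add: bimodule_def)
  from finite_projective_dual_basis[OF this fg proj] obtain G \<phi> where G: "finite G" "G \<subseteq> carrier A"
    and \<phi>: "\<And>g x. g \<in> G \<Longrightarrow> x \<in> carrier A \<Longrightarrow> \<phi> g x \<in> carrier B"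
      "\<And>g x y. g \<in> G \<Longrightarrow> x \<in> carrier A \<Longrightarrow> y \<in> carrier A \<Longrightarrow> \<phi> g (x \<oplus> y) = \<phi> g x \<oplus>\<^bsub>B\<^esub> \<phi> g y"
      "\<And>g x b. g \<in> G \<Longrightarrow> x \<in> carrier A \<Longrightarrow> b \<in> carrier B \<Longrightarrow> \<phi> g (x \<otimes> \<beta> b) = \<phi> g x \<otimes>\<^bsub>B\<^esub> b"
      "\<And>x. x \<in> carrier A \<Longrightarrow> (\<Oplus>g\<in>G. g \<otimes> \<beta> (\<phi> g x)) = x"
    by (simp add: finsum_ring_bimod) blast
  have GA: "g \<in> carrier A" if "g \<in> G" for g using that G by auto
  define F where "F g = (\<lambda>x\<in>carrier A. \<beta> (\<phi> g x))" for g
  have F: "F g \<in> carrier E" if "g \<in> G" for g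
    using that \<phi> by (auto simp: F_def mem_End_iff)
  define U where "U k = q k \<one>" for k
  define t where "t k = (\<Oplus>\<^bsub>AA\<^esub>g\<in>G. pt g (p k (F g)))" for k
  note pc = T.pure_tensor_closed[simplified]
  note pF = p'(1)[OF _ F]
  have tsum: "(\<lambda>g. pt g (p k (F g))) \<in> G \<rightarrow> carrier AA" if "k < n" for k
    using that by (auto intro!: pc simp: pF GA)
  have t: "t k \<in> carrier AA" if "k < n" for k
    unfolding t_def using tsum[OF that] by (rule T.MN.finsum_closed)
  have U: "U k \<in> carrier E" if "k < n" for k using that by (simp add: U_def q')
  have qU: "q k a x = a \<otimes> U k x" if "k < n" "a \<in> carrier A" "x \<in> carrier A" for k a x
    using q'(4)[OF that(1,2) A.one_closed] that by (simp add: U_def)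
  \<comment> \<open>\<open>q k (\<beta> (\<gamma> c))\<close> is computed twice: by right
    \<open>C\<close>-linearity and by left \<open>A\<close>-linearity of \<open>q k\<close>.\<close>
  have Uc: "U k (\<beta> (\<gamma> c) \<otimes> x) = \<beta> (\<gamma> c) \<otimes> U k x" if "k < n" "c \<in> carrier C" "x \<in> carrier A" for k c x
    using fun_cong[OF q'(3)[OF that(1) A.one_closed that(2)], of x] that EndD(1)[OF U]
    by (simp add: qU)
  have expand: "(\<Oplus>k\<in>{..<n}. p k f \<otimes> U k x) = f x" if "f \<in> carrier E" "x \<in> carrier A" for f x
  proof -
    have c: "(\<lambda>k. q k (p k f)) \<in> {..<n} \<rightarrow> carrier E" using that by (auto intro!: p' q')
    have "f x = (\<Oplus>k\<in>{..<n}. q k (p k f) x)"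
      using abelian_group_hom.hom_finsum[OF End_apply_hom[OF that(2)] c] sum[OF that(1)] by simp
    also have "\<dots> = (\<Oplus>k\<in>{..<n}. p k f \<otimes> U k x)"
      using that by (intro A.finsum_cong') (auto simp: qU p' U EndD)
    finally show ?thesis by simp
  qed
  \<comment> \<open>The coefficients \<open>\<phi> h (?c \<otimes> g)\<close> expand
    \<open>?c \<otimes> g\<close> in the dual basis and also express \<open>F h\<close> acted on by
    \<open>c\<close> through the \<open>F g\<close>. Exchanging the two sums therefore moves
    \<open>c\<close> from left to right.\<close>
  have central: "c \<triangleright>\<^bsub>AA\<^esub> t k = t k \<triangleleft>\<^bsub>AA\<^esub> \<beta> (\<gamma> c)" if k: "k < n" and c: "c \<in> carrier C" for k c
  proof -
    let ?c = "\<beta> (\<gamma> c)"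
    have cA: "?c \<in> carrier A" using c by simp
    have cg: "?c \<otimes> g \<in> carrier A" if "g \<in> G" for g using cA GA[OF that] by simp
    \<comment> \<open>Expanding \<open>x\<close> in the dual basis inside
      \<open>F h (?c \<otimes> x)\<close> and pulling out the coefficients \<open>\<phi> g x\<close>
      by right \<open>B\<close>-linearity gives the sum on the right.\<close>
    have Fc: "F h \<triangleleft>\<^bsub>E\<^esub> c = (\<Oplus>\<^bsub>E\<^esub>g\<in>G. \<beta> (\<phi> h (?c \<otimes> g)) \<triangleright>\<^bsub>E\<^esub> F g)" (is "_ = finsum E ?r G") if h: "h \<in> G" for h
    proof (rule End_eqI)
      show "F h \<triangleleft>\<^bsub>E\<^esub> c \<in> carrier E" using F[OF h] c by (rule E.rsm_closed)
      have rc: "?r \<in> G \<rightarrow> carrier E" using h F cg \<phi>(1) by (auto intro!: E.lsm_closed simp del: End_simps)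
      then show "finsum E ?r G \<in> carrier E" by (rule E.M.finsum_closed)
      fix x assume x: "x \<in> carrier A"
      interpret h: abelian_group_hom A A "F h"
        using EndD[OF F[OF h]] by (intro abelian_group_homI' A.abelian_group_axioms) auto
      have "finsum E ?r G x = (\<Oplus>g\<in>G. ?r g x)"
        using abelian_group_hom.hom_finsum[OF End_apply_hom[OF x] rc] .
      also have "\<dots> = (\<Oplus>g\<in>G. F h (?c \<otimes> (g \<otimes> \<beta> (\<phi> g x))))"
        using x h cA by (intro A.finsum_cong') (auto simp: F_def \<phi> GA simp flip: A.m_assoc)
      also have "\<dots> = F h (\<Oplus>g\<in>G. ?c \<otimes> (g \<otimes> \<beta> (\<phi> g x)))"
        using x cA by (intro h.hom_finsum[symmetric]) (auto simp: \<phi> GA)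
      also have "(\<Oplus>g\<in>G. ?c \<otimes> (g \<otimes> \<beta> (\<phi> g x))) = ?c \<otimes> x"
        using x abelian_group_hom.hom_finsum[OF A.mult_left_hom[OF cA], of "\<lambda>g. g \<otimes> \<beta> (\<phi> g x)" G]
        by (auto simp: \<phi> GA)
      finally have "finsum E ?r G x = F h (?c \<otimes> x)" .
      moreover have "(F h \<triangleleft>\<^bsub>E\<^esub> c) x = F h (?c \<otimes> x)" using x by simp
      ultimately show "(F h \<triangleleft>\<^bsub>E\<^esub> c) x = finsum E ?r G x" by (simp only:)
    qed
    have "c \<triangleright>\<^bsub>AA\<^esub> t k = (\<Oplus>\<^bsub>AA\<^esub>g\<in>G. c \<triangleright>\<^bsub>AA\<^esub> pt g (p k (F g)))"
      unfolding t_def using abelian_group_hom.hom_finsum[OF AA.lsm_hom[OF c] tsum[OF k]] .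
    also have "\<dots> = (\<Oplus>\<^bsub>AA\<^esub>g\<in>G. \<Oplus>\<^bsub>AA\<^esub>h\<in>G. pt h (\<beta> (\<phi> h (?c \<otimes> g)) \<otimes> p k (F g)))"
    proof (rule T.MN.finsum_cong')
      show "(\<lambda>g. \<Oplus>\<^bsub>AA\<^esub>h\<in>G. pt h (\<beta> (\<phi> h (?c \<otimes> g)) \<otimes> p k (F g))) \<in> G \<rightarrow> carrier AA"
        using k cA by (auto intro!: T.MN.finsum_closed pc simp: GA pF \<phi>)
      fix g assume g: "g \<in> G"
      have y: "p k (F g) \<in> carrier A" using pF[OF k g] .
      have "c \<triangleright>\<^bsub>AA\<^esub> pt g (p k (F g)) = pt (?c \<otimes> g) (p k (F g))"
        using c GA[OF g] y T.lsm_pure_tensor[of c g "p k (F g)"] by simp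
      also have "\<dots> = pt (\<Oplus>h\<in>G. h \<otimes> \<beta> (\<phi> h (?c \<otimes> g))) (p k (F g))" using cg[OF g] by (simp add: \<phi>)
      also have "\<dots> = (\<Oplus>\<^bsub>AA\<^esub>h\<in>G. pt (h \<otimes> \<beta> (\<phi> h (?c \<otimes> g))) (p k (F g)))"
        using y cg[OF g] abelian_group_hom.hom_finsum[OF T.pure_tensor_left_hom, of "p k (F g)" "\<lambda>h. h \<otimes> \<beta> (\<phi> h (?c \<otimes> g))" G]
        by (simp add: finsum_ring_bimod Pi_iff \<phi> GA)
      also have "\<dots> = (\<Oplus>\<^bsub>AA\<^esub>h\<in>G. pt h (\<beta> (\<phi> h (?c \<otimes> g)) \<otimes> p k (F g)))"
        using y cg[OF g] T.pure_tensor_balanced[simplified]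
        by (intro T.MN.finsum_cong') (auto intro!: pc simp: \<phi> GA)
      finally show "c \<triangleright>\<^bsub>AA\<^esub> pt g (p k (F g)) = (\<Oplus>\<^bsub>AA\<^esub>h\<in>G. pt h (\<beta> (\<phi> h (?c \<otimes> g)) \<otimes> p k (F g)))" .
    qed simp
    also have "\<dots> = (\<Oplus>\<^bsub>AA\<^esub>h\<in>G. \<Oplus>\<^bsub>AA\<^esub>g\<in>G. pt h (\<beta> (\<phi> h (?c \<otimes> g)) \<otimes> p k (F g)))"
      using k cA G(1) by (intro T.MN.finsum_swap) (auto intro!: pc simp: GA pF \<phi>)
    also have "\<dots> = (\<Oplus>\<^bsub>AA\<^esub>h\<in>G. pt h (p k (F h)) \<triangleleft>\<^bsub>AA\<^esub> ?c)"
    proof (rule T.MN.finsum_cong')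
      show "(\<lambda>h. pt h (p k (F h)) \<triangleleft>\<^bsub>AA\<^esub> ?c) \<in> G \<rightarrow> carrier AA"
        using k cA by (auto intro!: AA.rsm_closed pc simp: GA pF)
      fix h assume h: "h \<in> G"
      interpret p: abelian_group_hom E "ring_bimod A id (\<beta> \<circ> \<gamma>)" "p k"
        using p[OF k] bimodule_End bimodule_ring_bimods(4) by (rule bimod_hom_abelian_group_hom)
      have rc: "(\<lambda>g. \<beta> (\<phi> h (?c \<otimes> g)) \<triangleright>\<^bsub>E\<^esub> F g) \<in> G \<rightarrow> carrier E"
        using h F cg \<phi>(1) by (auto intro!: E.lsm_closed simp del: End_simps)
      have mc: "(\<lambda>g. \<beta> (\<phi> h (?c \<otimes> g)) \<otimes> p k (F g)) \<in> G \<rightarrow> carrier A"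
        using k h cg pF \<phi>(1) by auto
      have "(\<Oplus>\<^bsub>AA\<^esub>g\<in>G. pt h (\<beta> (\<phi> h (?c \<otimes> g)) \<otimes> p k (F g))) =
          pt h (\<Oplus>g\<in>G. \<beta> (\<phi> h (?c \<otimes> g)) \<otimes> p k (F g))"
        using mc GA[OF h] abelian_group_hom.hom_finsum[OF T.pure_tensor_right_hom, of h "\<lambda>g. \<beta> (\<phi> h (?c \<otimes> g)) \<otimes> p k (F g)" G]
        by (simp add: finsum_ring_bimod)
      \<comment> \<open>Left \<open>A\<close>-linearity of \<open>p k\<close> gathers the
        coefficients into the expansion \<open>Fc\<close>; its right \<open>C\<close>-linearity then
        releases \<open>?c\<close>.\<close>
      also have "(\<Oplus>g\<in>G. \<beta> (\<phi> h (?c \<otimes> g)) \<otimes> p k (F g)) = (\<Oplus>g\<in>G. p k (\<beta> (\<phi> h (?c \<otimes> g)) \<triangleright>\<^bsub>E\<^esub> F g))"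
        using k h cg F \<phi>(1) pF
        by (intro A.finsum_cong') (auto simp: bimod_homD(4)[OF p] E.lsm_closed simp del: End_simps intro!: bimod_homD(1)[OF p, simplified])
      also have "\<dots> = p k (F h \<triangleleft>\<^bsub>E\<^esub> c)"
        unfolding Fc[OF h] using p.hom_finsum[OF rc] by (simp only: finsum_ring_bimod)
      also have "\<dots> = p k (F h) \<otimes> ?c"
        using bimod_homD(3)[OF p[OF k] F[OF h] c] by simp
      also have "pt h (p k (F h) \<otimes> ?c) = pt h (p k (F h)) \<triangleleft>\<^bsub>AA\<^esub> ?c"
        using T.rsm_pure_tensor[of ?c h "p k (F h)"] cA GA[OF h] pF[OF k h] by simp
      finally show "(\<Oplus>\<^bsub>AA\<^esub>g\<in>G. pt h (\<beta> (\<phi> h (?c \<otimes> g)) \<otimes> p k (F g))) = pt h (p k (F h)) \<triangleleft>\<^bsub>AA\<^esub> ?c" .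
    qed simp
    also have "\<dots> = t k \<triangleleft>\<^bsub>AA\<^esub> ?c"
      unfolding t_def using abelian_group_hom.hom_finsum[OF AA.rsm_hom[OF cA] tsum[OF k]] by simp
    finally show ?thesis .
  qed
  \<comment> \<open>After exchanging sums, \<open>expand\<close> turns the second tensor factor into
    \<open>\<beta> (\<phi> g x)\<close>. This crosses to the first factor, where the dual basis
    reassembles \<open>x\<close>.\<close>
  have quasibase: "(\<Oplus>\<^bsub>AA\<^esub>k\<in>{..<n}. t k \<triangleleft>\<^bsub>AA\<^esub> U k x) = pt x \<one>" if x: "x \<in> carrier A" for x
  proof -
    have Ux: "U k x \<in> carrier A" if "k < n" for k using EndD(1)[OF U[OF that] x] .
    have "(\<Oplus>\<^bsub>AA\<^esub>k\<in>{..<n}. t k \<triangleleft>\<^bsub>AA\<^esub> U k x) = (\<Oplus>\<^bsub>AA\<^esub>k\<in>{..<n}. \<Oplus>\<^bsub>AA\<^esub>g\<in>G. pt g (p k (F g) \<otimes> U k x))"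
    proof (rule T.MN.finsum_cong')
      show "(\<lambda>k. \<Oplus>\<^bsub>AA\<^esub>g\<in>G. pt g (p k (F g) \<otimes> U k x)) \<in> {..<n} \<rightarrow> carrier AA"
        by (auto intro!: T.MN.finsum_closed pc simp: GA pF Ux)
      fix k assume "k \<in> {..<n}"
      then have k: "k < n" by simp
      have "t k \<triangleleft>\<^bsub>AA\<^esub> U k x = (\<Oplus>\<^bsub>AA\<^esub>g\<in>G. pt g (p k (F g)) \<triangleleft>\<^bsub>AA\<^esub> U k x)"
        unfolding t_def using abelian_group_hom.hom_finsum[OF AA.rsm_hom[OF Ux[OF k]] tsum[OF k]] .
      also have "\<dots> = (\<Oplus>\<^bsub>AA\<^esub>g\<in>G. pt g (p k (F g) \<otimes> U k x))"
        using k Ux[OF k] pF[OF k] GA T.rsm_pure_tensor[simplified]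
        by (intro T.MN.finsum_cong') (auto intro!: pc)
      finally show "t k \<triangleleft>\<^bsub>AA\<^esub> U k x = (\<Oplus>\<^bsub>AA\<^esub>g\<in>G. pt g (p k (F g) \<otimes> U k x))" .
    qed simp
    also have "\<dots> = (\<Oplus>\<^bsub>AA\<^esub>g\<in>G. \<Oplus>\<^bsub>AA\<^esub>k\<in>{..<n}. pt g (p k (F g) \<otimes> U k x))"
      using G(1) by (intro T.MN.finsum_swap) (auto intro!: pc simp: GA pF Ux)
    also have "\<dots> = (\<Oplus>\<^bsub>AA\<^esub>g\<in>G. pt (g \<otimes> \<beta> (\<phi> g x)) \<one>)"
    proof (rule T.MN.finsum_cong')
      show "(\<lambda>g. pt (g \<otimes> \<beta> (\<phi> g x)) \<one>) \<in> G \<rightarrow> carrier AA" using x by (auto intro!: pc simp: GA \<phi>)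
      fix g assume g: "g \<in> G"
      have "(\<lambda>k. p k (F g) \<otimes> U k x) \<in> {..<n} \<rightarrow> carrier A" using g pF Ux by auto
      then have "(\<Oplus>\<^bsub>AA\<^esub>k\<in>{..<n}. pt g (p k (F g) \<otimes> U k x)) = pt g (\<Oplus>k\<in>{..<n}. p k (F g) \<otimes> U k x)"
        using GA[OF g] abelian_group_hom.hom_finsum[OF T.pure_tensor_right_hom, of g "\<lambda>k. p k (F g) \<otimes> U k x" "{..<n}"]
        by (simp add: finsum_ring_bimod)
      also have "\<dots> = pt g (\<beta> (\<phi> g x))" using expand[OF F[OF g] x] x by (simp add: F_def)
      also have "\<dots> = pt (g \<otimes> \<beta> (\<phi> g x)) \<one>"
        using T.pure_tensor_balanced[of g "\<phi> g x" \<one>] g x by (simp add: GA \<phi>)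
      finally show "(\<Oplus>\<^bsub>AA\<^esub>k\<in>{..<n}. pt g (p k (F g) \<otimes> U k x)) = pt (g \<otimes> \<beta> (\<phi> g x)) \<one>" .
    qed simp
    also have "\<dots> = pt (\<Oplus>g\<in>G. g \<otimes> \<beta> (\<phi> g x)) \<one>"
      using x abelian_group_hom.hom_finsum[OF T.pure_tensor_left_hom, of \<one> "\<lambda>g. g \<otimes> \<beta> (\<phi> g x)" G]
      by (simp add: finsum_ring_bimod Pi_iff \<phi> GA)
    finally show ?thesis using x by (simp add: \<phi>)
  qed
  have "ev (U k) \<in> bimod_hom C A AA (ring_bimod A (\<beta> \<circ> \<gamma>) id)" if k: "k < n" for k
    using abelian_group_hom.hom_add[OF ev_hom[OF U[OF k]]]
    by (intro bimod_homI) (auto simp: ev_closed U k ev_rsm ev_lsm Uc)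
  \<comment> \<open>Left \<open>C\<close>-linearity of this map is precisely the centrality of
    \<open>t k\<close>.\<close>
  moreover have "(\<lambda>a. t k \<triangleleft>\<^bsub>AA\<^esub> a) \<in> bimod_hom C A (ring_bimod A (\<beta> \<circ> \<gamma>) id) AA" if k: "k < n" for k
    by (rule bimod_homI)
      (simp_all add: t k AA.rsm_closed AA.rsm_add_scalar AA.rsm_mult AA.lsm_rsm flip: central)
  \<comment> \<open>A pure tensor is \<open>pt x \<one>\<close> multiplied by \<open>y\<close> on
    the right, so \<open>quasibase\<close> multiplied by \<open>y\<close> settles pure tensors;
    additivity in \<open>z\<close> does the rest.\<close>
  moreover have "(\<Oplus>\<^bsub>AA\<^esub>k\<in>{..<n}. t k \<triangleleft>\<^bsub>AA\<^esub> ev (U k) z) = z" if z: "z \<in> carrier AA" for z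
  proof (rule T.tensor_hom_eqI[OF _ _ _ z])
    have c: "(\<lambda>k. t k \<triangleleft>\<^bsub>AA\<^esub> ev (U k) z) \<in> {..<n} \<rightarrow> carrier AA" if "z \<in> carrier AA" for z
      using that by (auto intro!: AA.rsm_closed t ev_closed U)
    show "abelian_group_hom AA AA (\<lambda>z. \<Oplus>\<^bsub>AA\<^esub>k\<in>{..<n}. t k \<triangleleft>\<^bsub>AA\<^esub> ev (U k) z)"
    proof (rule abelian_group_homI'[OF T.MN.abelian_group_axioms T.MN.abelian_group_axioms])
      show "(\<lambda>z. \<Oplus>\<^bsub>AA\<^esub>k\<in>{..<n}. t k \<triangleleft>\<^bsub>AA\<^esub> ev (U k) z) \<in> carrier AA \<rightarrow> carrier AA"
        using c by (auto intro!: T.MN.finsum_closed)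
      fix y z assume yz: "y \<in> carrier AA" "z \<in> carrier AA"
      show "(\<Oplus>\<^bsub>AA\<^esub>k\<in>{..<n}. t k \<triangleleft>\<^bsub>AA\<^esub> ev (U k) (y \<oplus>\<^bsub>AA\<^esub> z)) =
        (\<Oplus>\<^bsub>AA\<^esub>k\<in>{..<n}. t k \<triangleleft>\<^bsub>AA\<^esub> ev (U k) y) \<oplus>\<^bsub>AA\<^esub> (\<Oplus>\<^bsub>AA\<^esub>k\<in>{..<n}. t k \<triangleleft>\<^bsub>AA\<^esub> ev (U k) z)"
        unfolding T.MN.finsum_addf[OF c[OF yz(1)] c[OF yz(2)], symmetric]
        using yz c by (intro T.MN.finsum_cong')
          (auto simp: abelian_group_hom.hom_add[OF ev_hom[OF U]] AA.rsm_add_scalar t ev_closed U AA.rsm_closed)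
    qed
    show "abelian_group_hom AA AA (\<lambda>z. z)" by (rule abelian_group_hom_id[OF T.MN.abelian_group_axioms])
    fix x y assume "x \<in> carrier (ring_bimod A (\<beta> \<circ> \<gamma>) \<beta>)" "y \<in> carrier (ring_bimod A \<beta> id)"
    then have x: "x \<in> carrier A" and y: "y \<in> carrier A" by auto
    have Ux: "U k x \<in> carrier A" if "k < n" for k using EndD(1)[OF U[OF that] x] .
    have "(\<Oplus>\<^bsub>AA\<^esub>k\<in>{..<n}. t k \<triangleleft>\<^bsub>AA\<^esub> ev (U k) (pt x y)) = (\<Oplus>\<^bsub>AA\<^esub>k\<in>{..<n}. (t k \<triangleleft>\<^bsub>AA\<^esub> U k x) \<triangleleft>\<^bsub>AA\<^esub> y)"
      using x y by (intro T.MN.finsum_cong') (auto simp: ev_pure U AA.rsm_mult t Ux AA.rsm_closed)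
    also have "\<dots> = (\<Oplus>\<^bsub>AA\<^esub>k\<in>{..<n}. t k \<triangleleft>\<^bsub>AA\<^esub> U k x) \<triangleleft>\<^bsub>AA\<^esub> y"
      by (rule abelian_group_hom.hom_finsum[OF AA.rsm_hom[OF y], symmetric])
        (auto intro!: AA.rsm_closed t Ux)
    also have "\<dots> = pt x y"
      using quasibase[OF x] T.rsm_pure_tensor[of y x \<one>] x y by simp
    finally show "(\<Oplus>\<^bsub>AA\<^esub>k\<in>{..<n}. t k \<triangleleft>\<^bsub>AA\<^esub> ev (U k) (pt x y)) = pt x y" .
  qed
  ultimately show ?thesis
    unfolding left_depth_three_iff
    using n by (intro exI[of _ n] conjI exI[of _ "\<lambda>k. ev (U k)"] exI[of _ "\<lambda>k a. t k \<triangleleft>\<^bsub>AA\<^esub> a"]) auto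
qed

end

theorem proposition2p8:
  fixes A :: "('a, 'x) ring_scheme" and B :: "('b, 'y) ring_scheme" and C :: "('c, 'z) ring_scheme"
    and \<beta> :: "'b \<Rightarrow> 'a" and \<gamma> :: "'c \<Rightarrow> 'b"
  assumes "ring_tower A B C \<beta> \<gamma>"
    and "finitely_generated B (ring_bimod A id \<beta>)"
    and "projective B (ring_bimod A id \<beta>)"
  shows "left_depth_three A B C \<beta> \<gamma> \<longleftrightarrow>
    (\<exists>N::nat. 0 < N \<and>
      iso_direct_summand A C
        (End_bimod A B \<beta> \<gamma>)
        (bimod_power (ring_bimod A id (\<beta> \<circ> \<gamma>)) N))"
  using ring_tower.left_depth_three_imp_End[OF assms(1)]
    ring_tower.End_imp_left_depth_three[OF assms(1-3)] by blast

end
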